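(* Let $D$ be an $n$-vertex eulerian digraph with $\delta(D_{\mathrm{us}})\ge (4n+2)/5$, where $\delta(D_{\mathrm{us}})$ is the minimum degree of the underlying simple undirected graph of $D$. Let $T$ be a directed euler circuit in $D$. Then there is an oriented directed embedding of $D$ with $T$ as the only proface, and with exactly one or two antifaces, depending on whether $|V(D)|+|A(D)|$ is even or odd, respectively. This embedding has maximum genus among all orientable directed embeddings of $D$. When $|V(D)|+|A(D)|$ is even, this embedding is an orientable bi-eulerian directed embedding of $D$ with $T$ as a specified face.
   Context: Digraphs are finite and may have loops and multiple arcs; $V(D)$ and $A(D)$ are the sets of vertices and arcs. An eulerian digraph is a connected digraph in which every vertex has indegree equal to outdegree. $D_{\mathrm{us}}$ is the simple undirected graph on $V(D)$ in which distinct $u,v$ are adjacent if and only if there is an arc of $D$ (in either direction) between $u$ and $v$. A directed euler circuit is a closed directed walk, considered up to cyclic shift, that uses every arc exactly once and contains every vertex. All embeddings are cellular embeddings in closed surfaces; a face is identified with its facial boundary walk. A directed embedding of $D$ is an embedding in which every face is bounded by a directed closed walk of $D$; equivalently, the half-arcs around each vertex, in rotational order, alternate between entering and leaving. An oriented embedding is an embedding in an orientable surface with a chosen global clockwise orientation. In an oriented directed embedding each face is either a proface (facial walk directed clockwise) or an antiface (facial walk directed anticlockwise). Combinatorially, an oriented directed embedding is given by a clockwise cyclic order, alternating in direction, of the half-arcs at each vertex; a proface entering a vertex on an incoming half-arc $h$ leaves on the half-arc immediately preceding $h$ in the clockwise order, and an antiface entering on $h$ leaves on the half-arc immediately following $h$.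 A directed embedding is bi-eulerian if it has exactly two faces, each bounded by a directed euler circuit. *)

theory Defs
  imports
    Complex_Main
    "HOL-Combinatorics.Combinatorics"
    "Graph_Theory.Graph_Theory"
begin

definition eulerian_digraph :: "('a, 'b) pre_digraph \<Rightarrow> bool" where
  "eulerian_digraph D \<longleftrightarrow>
     fin_digraph D \<and> Digraph_Component.connected D \<and>
     (\<forall>v\<in>verts D. in_degree D v = out_degree D v)"

(* As usual in Graph_Theory, an undirected edge is a pair of opposite arcs.  Unlike
   mk_symmetric, loops are dropped, so the degree of a vertex is its out_degree. *)
definition underlying_simple :: "('a, 'b) pre_digraph \<Rightarrow> 'a pair_pre_digraph" where
  "underlying_simple D = \<lparr> pverts = verts D,
     parcs = {(u, v). u \<noteq> v \<and> (\<exists>a\<in>arcs D.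
       (tail D a = u \<and> head D a = v) \<or> (tail D a = v \<and> head D a = u))} \<rparr>"

definition min_degree :: "('a, 'b) pre_digraph \<Rightarrow> nat" where
  "min_degree G = Min (out_degree G ` verts G)"

(* Closed walks are arc lists; a closed walk up to cyclic shift is the set of its rotations. *)
definition cyclic_walk :: "'b list \<Rightarrow> 'b list set" where
  "cyclic_walk p = {rotate k p | k. True}"

definition directed_euler_circuit :: "('a, 'b) pre_digraph \<Rightarrow> 'b list set \<Rightarrow> bool" where
  "directed_euler_circuit D T \<longleftrightarrow>
     (\<exists>u p. pre_digraph.euler_trail D u p u \<and> T = cyclic_walk p)"

datatype 'b half_arc = Entering (arc_of: 'b) | Leaving (arc_of: 'b)

fun half_arc_vertex :: "('a, 'b) pre_digraph \<Rightarrow> 'b half_arc \<Rightarrow> 'a" where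
  "half_arc_vertex D (Entering a) = head D a"
| "half_arc_vertex D (Leaving a) = tail D a"

definition half_arcs :: "('a, 'b) pre_digraph \<Rightarrow> 'b half_arc set" where
  "half_arcs D = {h. arc_of h \<in> arcs D}"

definition half_arcs_at :: "('a, 'b) pre_digraph \<Rightarrow> 'a \<Rightarrow> 'b half_arc set" where
  "half_arcs_at D v = {h \<in> half_arcs D. half_arc_vertex D h = v}"

(* The embedding is represented by its rotation system: \<rho> h is the half-arc immediately
   following h in the clockwise order at the vertex of h. *)
definition oriented_directed_embedding ::
    "('a, 'b) pre_digraph \<Rightarrow> ('b half_arc \<Rightarrow> 'b half_arc) \<Rightarrow> bool" where
  "oriented_directed_embedding D \<rho> \<longleftrightarrow>
     \<rho> permutes half_arcs D \<and>
     (\<forall>v\<in>verts D. half_arcs_at D v \<noteq> {} \<longrightarrow> cyclic_on \<rho> (half_arcs_at D v)) \<and>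
     (\<forall>h\<in>half_arcs D. is_Entering (\<rho> h) \<longleftrightarrow> \<not> is_Entering h)"

definition proface_step :: "('b half_arc \<Rightarrow> 'b half_arc) \<Rightarrow> 'b \<Rightarrow> 'b" where
  "proface_step \<rho> a = arc_of (inv \<rho> (Entering a))"

definition antiface_step :: "('b half_arc \<Rightarrow> 'b half_arc) \<Rightarrow> 'b \<Rightarrow> 'b" where
  "antiface_step \<rho> a = arc_of (\<rho> (Entering a))"

(* For a permutation f of a finite set, support f a = [a, f a, f (f a), ...] runs once
   through the cycle of f containing a. *)
definition profaces ::
    "('a, 'b) pre_digraph \<Rightarrow> ('b half_arc \<Rightarrow> 'b half_arc) \<Rightarrow> 'b list set set" where
  "profaces D \<rho> = (\<lambda>a. cyclic_walk (support (proface_step \<rho>) a)) ` arcs D"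

definition antifaces ::
    "('a, 'b) pre_digraph \<Rightarrow> ('b half_arc \<Rightarrow> 'b half_arc) \<Rightarrow> 'b list set set" where
  "antifaces D \<rho> = (\<lambda>a. cyclic_walk (support (antiface_step \<rho>) a)) ` arcs D"

(* The union has to be disjoint: a proface and an antiface can be bounded by the same
   directed closed walk. *)
definition faces ::
    "('a, 'b) pre_digraph \<Rightarrow> ('b half_arc \<Rightarrow> 'b half_arc) \<Rightarrow> ('b list set + 'b list set) set" where
  "faces D \<rho> = profaces D \<rho> <+> antifaces D \<rho>"

(* Euler's formula |V| - |A| + |F| = 2 - 2g, for connected D with at least one arc (without
   arcs the single face is not counted by faces).  Real division, so that nothing is rounded. *)
definition genus :: "('a, 'b) pre_digraph \<Rightarrow> ('b half_arc \<Rightarrow> 'b half_arc) \<Rightarrow> real" where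
  "genus D \<rho> =
     (2 - (real (card (verts D)) - real (card (arcs D)) + real (card (faces D \<rho>)))) / 2"

definition bi_eulerian :: "('a, 'b) pre_digraph \<Rightarrow> ('b half_arc \<Rightarrow> 'b half_arc) \<Rightarrow> bool" where
  "bi_eulerian D \<rho> \<longleftrightarrow>
     oriented_directed_embedding D \<rho> \<and> card (faces D \<rho>) = 2 \<and>
     (\<forall>W \<in> profaces D \<rho> \<union> antifaces D \<rho>. directed_euler_circuit D W)"

end

theory Submission
  imports Defs "HOL-Library.Sublist"
begin

text \<open>
  A directed embedding with \<open>T\<close> as its only proface is a permutation \<open>c\<close> of the arcs that acts on the
  arcs entering each vertex as a single cycle; its antifaces are the cycles of \<open>t \<circ> c\<close>, where \<open>t\<close> is
  the cyclic permutation \<open>T\<close>. We start from \<open>c = id\<close> and multiply \<open>c\<close> by 3-cycles at one vertex or by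
  two transpositions at two vertices \<open>w\<close>, \<open>y\<close>, always keeping \<open>t \<circ> c\<close> a single cycle, that is, an
  euler circuit. A 3-cycle of the right orientation only exchanges two segments of the circuit; two
  transpositions are possible when the circuit interlaces \<open>w\<close> and \<open>y\<close>. The 3-cycles reduce the number
  of cycles of \<open>c\<close> at each vertex to one or two, and two transpositions repair two vertices of wrong
  parity. So if any two vertices can be interlaced after at most one exchange, at most one vertex of
  wrong parity is left, and one more transposition there splits the circuit into two antifaces.

  Suppose that no exchange interlaces \<open>w\<close> and \<open>y\<close>. Then the circuit is \<open>P K Y L\<close> with all \<open>w\<close> in \<open>P\<close>
  and all \<open>y\<close> in \<open>Y\<close>, and a common neighbour of \<open>w\<close> and \<open>y\<close> that is not at an end of \<open>K\<close> or \<open>L\<close> occurs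
  only in one gap between consecutive \<open>w\<close>'s and in one gap between consecutive \<open>y\<close>'s, and at an end of
  each. The degree condition yields three such vertices that are pairwise adjacent. Two of the three
  adjacencies are in \<open>P\<close>, say, and put all three vertices at the two ends of the same gap.

  By the sign of permutations the parity of the number of antifaces is forced, which gives both the
  number of antifaces and the maximality of the genus.
\<close>

section \<open>Cyclic words\<close>

text \<open>In other words, all occurrences of \<open>s\<close> lie in one gap between consecutive
  occurrences of \<open>w\<close>. The form with splittings matches the decompositions on which an
  exchange acts.\<close>

definition single_gap :: "'a \<Rightarrow> 'a \<Rightarrow> 'a list \<Rightarrow> bool" where
  "single_gap w s P \<longleftrightarrow> (\<forall>A B C. P = A @ [s] @ B @ [s] @ C \<longrightarrow> w \<notin> set B)"

lemma takeWhile_before: "s \<notin> set A \<Longrightarrow> takeWhile (\<lambda>x. x \<noteq> s) (A @ s # B) = A"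
  by (induction A) auto

text \<open>The number of \<open>w\<close>'s before an occurrence of \<open>s\<close> numbers its
  gap. No \<open>w\<close> lies between the first \<open>s\<close> and a later one, so the first one
  can stand for all of them.\<close>

lemma count_list_before:
  assumes "single_gap w s P" "w \<noteq> s" "P = A @ s # B"
  shows "count_list A w = count_list (takeWhile (\<lambda>x. x \<noteq> s) P) w"
proof (cases "s \<in> set A")
  case False
  then show ?thesis using assms(3) takeWhile_before by metis
next
  case True
  then obtain A1 A2 where A: "A = A1 @ s # A2" and s: "s \<notin> set A1"
    by (meson split_list_first)
  have "w \<notin> set A2"
    using assms A unfolding single_gap_def by (metis append_Cons append_Nil append_assoc)
  moreover have "takeWhile (\<lambda>x. x \<noteq> s) P = A1"
    unfolding assms(3) A append_assoc append_Cons by (rule takeWhile_before[OF s])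
  ultimately show ?thesis using assms A by simp
qed

lemma append_Cons_eq_by_count:
  assumes "A @ w # B = A' @ w # B'" "count_list A w = count_list A' w"
  shows "A = A' \<and> B = B'"
  using assms
proof (induction A arbitrary: A')
  case Nil
  then show ?case by (cases A') (auto split: if_splits)
next
  case (Cons a A)
  then show ?case by (cases A') (auto split: if_splits)
qed

lemma sublist_pair_iff: "sublist [a, b] P \<longleftrightarrow> (\<exists>A B. P = A @ a # b # B)"
  by (auto simp: sublist_def)

text \<open>Neighbouring letters other than \<open>w\<close> lie in the same gap, so
  \<open>a\<close>, \<open>b\<close>, \<open>c\<close> share one gap. Each of them stands at one of
  its two ends, next to the \<open>w\<close> that bounds it, and two of the three would have to
  stand at the same end.\<close>

lemma single_gap_no_fork:
  assumes gap: "\<And>s. s \<in> {a, b, c} \<Longrightarrow> single_gap w s P \<and> s \<noteq> w"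
    and at_w: "\<And>s. s \<in> {a, b, c} \<Longrightarrow> sublist [w, s] P \<or> sublist [s, w] P"
    and ab: "sublist [a, b] P \<or> sublist [b, a] P"
    and ac: "sublist [a, c] P \<or> sublist [c, a] P"
    and dist: "distinct [a, b, c]"
  shows False
proof -
  \<comment> \<open>\<open>g s\<close> is the number of the gap that contains
    \<open>s\<close>.\<close>
  define g where "g s = count_list (takeWhile (\<lambda>x. x \<noteq> s) P) w" for s
  have g: "count_list A w = g s" if "s \<in> {a, b, c}" "P = A @ s # B" for A B s
    unfolding g_def using count_list_before gap that by metis
  have same: "g s = g t" if sub: "sublist [s, t] P" and st: "s \<in> {a, b, c}" "t \<in> {a, b, c}" for s t
  proof -
    obtain A B where "P = A @ s # t # B" using sub unfolding sublist_pair_iff by blast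
    then have "count_list A w = g s" "count_list (A @ [s]) w = g t"
      using g[OF st(1)] g[OF st(2), of "A @ [s]"] by auto
    then show ?thesis using gap[OF st(1)] by simp
  qed
  have eq: "g b = g a" "g c = g a" using same ab ac by (metis insertCI)+
  have after: "s = t" if sub: "sublist [w, s] P" "sublist [w, t] P" "g s = g t"
    and st: "s \<in> {a, b, c}" "t \<in> {a, b, c}" for s t
  proof -
    obtain A B A' B' where P: "P = A @ w # s # B" "P = A' @ w # t # B'"
      using sub unfolding sublist_pair_iff by blast
    have "count_list (A @ [w]) w = g s" "count_list (A' @ [w]) w = g t"
      using g[OF st(1), of "A @ [w]" B] g[OF st(2), of "A' @ [w]" B'] P by (simp, metis append_assoc append_Cons append_Nil)
    then show ?thesis
      using append_Cons_eq_by_count[of A w "s # B" A' "t # B'"] P sub(3) by simp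
  qed
  have before: "s = t" if sub: "sublist [s, w] P" "sublist [t, w] P" "g s = g t"
    and st: "s \<in> {a, b, c}" "t \<in> {a, b, c}" for s t
  proof -
    obtain A B A' B' where P: "P = A @ s # w # B" "P = A' @ t # w # B'"
      using sub unfolding sublist_pair_iff by blast
    have "count_list (A @ [s]) w = count_list (A' @ [t]) w"
      using g[OF st(1) P(1)] g[OF st(2) P(2)] sub(3) gap[OF st(1)] gap[OF st(2)] by simp
    then show ?thesis
      using append_Cons_eq_by_count[of "A @ [s]" w B "A' @ [t]" B'] P by simp
  qed
  have A: "a \<in> {a,b,c}" "b \<in> {a,b,c}" "c \<in> {a,b,c}" by auto
  have "(sublist [w, a] P \<and> sublist [w, b] P) \<or> (sublist [w, a] P \<and> sublist [w, c] P) \<or>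
     (sublist [w, b] P \<and> sublist [w, c] P) \<or>
     (sublist [a, w] P \<and> sublist [b, w] P) \<or> (sublist [a, w] P \<and> sublist [c, w] P) \<or>
     (sublist [b, w] P \<and> sublist [c, w] P)"
    using at_w[OF A(1)] at_w[OF A(2)] at_w[OF A(3)] by blast
  then show False
    using after[OF _ _ _ A(1,2)] after[OF _ _ _ A(1,3)] after[OF _ _ _ A(2,3)]
      before[OF _ _ _ A(1,2)] before[OF _ _ _ A(1,3)] before[OF _ _ _ A(2,3)] eq dist
    by auto
qed

section \<open>Words in which two letters are not interlaced\<close>

text \<open>After a rotation all \<open>w\<close>'s come before all \<open>y\<close>'s. Then
  \<open>P\<close> runs from the first to the last \<open>w\<close>, \<open>Y\<close> from the first
  to the last \<open>y\<close>, and \<open>K\<close>, \<open>L\<close> are the two remaining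
  stretches.\<close>

lemma not_interlaced_blocks:
  assumes "w \<in> set u" "y \<in> set u" "w \<noteq> y"
    and no: "\<And>k. \<not> subseq [w, y, w, y] (rotate k u)"
  obtains k P K Y L where "rotate k u = P @ K @ Y @ L"
    "P \<noteq> []" "hd P = w" "last P = w" "y \<notin> set P"
    "Y \<noteq> []" "hd Y = y" "last Y = y" "w \<notin> set Y"
    "{w, y} \<inter> (set K \<union> set L) = {}"
proof -
  have rot: "\<exists>k. rotate k u = B @ A" if "rotate i u = A @ B" for i A B
    using that by (metis rotate_append rotate_rotate)
  obtain A B where u: "u = A @ y # B" using assms(2) split_list by metis
  have "w \<in> set (B @ A)" using assms u by auto
  then obtain A1 A2 where BA: "B @ A = A1 @ w # A2" and A1: "w \<notin> set A1"
    by (meson split_list_first)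
  \<comment> \<open>The final rotation starts with the first \<open>w\<close> after some
    \<open>y\<close>. That \<open>y\<close> comes after every \<open>w\<close>, because
    \<open>A1\<close> contains none.\<close>
  obtain i where "rotate i u = (y # B) @ A" using rot[of 0 A "y # B"] u by auto
  then obtain k where k: "rotate k u = w # A2 @ y # A1"
    using rot[of i "y # A1" "w # A2"] BA by auto
  obtain X1 X2 where X: "w # A2 @ y # A1 = X1 @ y # X2" and yX1: "y \<notin> set X1"
    by (metis split_list_first Cons_eq_appendI in_set_conv_decomp)
  have wX2: "w \<notin> set X2"
  proof
    assume wX: "w \<in> set X2"
    then obtain Z1 Z2 where Z: "X2 = Z1 @ w # Z2" "w \<notin> set Z2" by (meson split_list_last)
    \<comment> \<open>The \<open>y\<close> in front of \<open>A1\<close> lies behind the last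
      \<open>w\<close>; together with the initial \<open>w\<close> and the first \<open>y\<close>
      this gives the forbidden pattern.\<close>
    have "y \<in> set Z2"
    proof (rule ccontr)
      assume "y \<notin> set Z2"
      have "(w # A2) @ y # A1 = (X1 @ y # Z1) @ w # Z2" using X Z by simp
      from append_eq_append_conv2[THEN iffD1, OF this] consider S where "w # A2 = X1 @ y # Z1 @ S" "S @ y # A1 = w # Z2"
        | S where "w # A2 @ S = X1 @ y # Z1" "y # A1 = S @ w # Z2"
        by auto
      then show False
      proof cases
        case 1 then show False using \<open>y \<notin> set Z2\<close> assms(3) by (cases S) auto
      next
        case 2 then show False using A1 assms(3) by (cases S) auto
      qed
    qed
    then have "subseq [w, y] (w # Z2)" by (simp add: subseq_singleton_left)
    moreover have "w \<in> set X1" using X assms(3) by (cases X1) auto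
    ultimately have "subseq ([w] @ [y] @ [] @ [w, y]) (X1 @ [y] @ Z1 @ w # Z2)"
      by (intro list_emb_append_mono) (auto simp: subseq_singleton_left)
    then show False using no[of k] k X Z by simp
  qed
  have "w \<in> set X1" using X assms(3) by (cases X1) auto
  then obtain P1 K where P: "X1 = P1 @ w # K" "w \<notin> set K" by (meson split_list_last)
  have "y \<in> set (y # X2)" by simp
  then obtain Y1 L where Y: "y # X2 = Y1 @ y # L" "y \<notin> set L" by (meson split_list_last)
  have "rotate k u = (P1 @ [w]) @ K @ (Y1 @ [y]) @ L" using k X P Y by simp
  moreover have "hd (P1 @ [w]) = w" using X P by (cases P1) auto
  moreover have "hd (Y1 @ [y]) = y" using Y by (cases Y1) auto
  moreover have "w \<notin> set (y # X2)" using wX2 assms(3) by simp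
  then have "w \<notin> set (Y1 @ [y])" "w \<notin> set L" unfolding Y(1) by auto
  ultimately show ?thesis
    using that[of k "P1 @ [w]" K "Y1 @ [y]" L] yX1 P Y by auto
qed

lemma sublist_pair_append:
  "sublist [a, b] (xs @ ys) \<longleftrightarrow> sublist [a, b] xs \<or> sublist [a, b] ys \<or>
     (xs \<noteq> [] \<and> ys \<noteq> [] \<and> last xs = a \<and> hd ys = b)"
proof -
  have 1: "suffix [a] xs \<longleftrightarrow> xs \<noteq> [] \<and> last xs = a"
    by (cases xs rule: rev_cases) (auto simp: suffix_def)
  have 2: "prefix [b] ys \<longleftrightarrow> ys \<noteq> [] \<and> hd ys = b"
    by (cases ys) auto
  have 3: "(\<exists>x1 x2. [a, b] = x1 @ x2 \<and> suffix x1 xs \<and> prefix x2 ys) \<longleftrightarrow>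
      prefix [a, b] ys \<or> (suffix [a] xs \<and> prefix [b] ys) \<or> suffix [a, b] xs"
    by (auto simp: Cons_eq_append_conv)
       (metis append_Cons append_Nil append_Nil2 prefix_bot.extremum suffix_bot.extremum)+
  show ?thesis
    unfolding sublist_append 3 using 1 2 by (auto intro: prefix_imp_sublist suffix_imp_sublist)
qed


text \<open>\<open>A\<close> supplies the first \<open>w\<close> and the segment \<open>C\<close>,
  moved forward, the first \<open>y\<close>, so the rest has to supply only the second pair.\<close>

lemma subseq_exchange:
  assumes "w \<in> set A" "y \<in> set C" "subseq [w, y] (B @ [s] @ D)"
  shows "subseq [w, y, w, y] (A @ [s] @ C @ [s] @ B @ [s] @ D)"
proof -
  have "subseq ([w] @ [] @ [y] @ [] @ [w, y]) (A @ [s] @ C @ [s] @ (B @ [s] @ D))"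
    using assms by (intro list_emb_append_mono) (auto simp: subseq_singleton_left)
  then show ?thesis by simp
qed

lemma subseq_pairI:
  assumes "w \<in> set A" "y \<in> set B"
  shows "subseq [w, y] (A @ B)"
  using list_emb_append_mono[of "(=)" "[w]" A "[y]" B] assms
  by (simp add: subseq_singleton_left)

text \<open>\<open>s\<close> has a \<open>w\<close> on both sides within \<open>P\<close> and a
  \<open>y\<close> on both sides within \<open>Y\<close>. A further occurrence in \<open>K\<close>
  or \<open>L\<close>, or beyond a \<open>w\<close> in \<open>P\<close> or a \<open>y\<close> in
  \<open>Y\<close>, gives three occurrences of \<open>s\<close> at which the exchange interlaces
  \<open>w\<close> and \<open>y\<close>.\<close>

lemma blocks_no_exchange:
  assumes no: "\<And>A B C D. P @ K @ Y @ L = A @ [s] @ B @ [s] @ C @ [s] @ D \<Longrightarrow>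
      \<not> subseq [w, y, w, y] (A @ [s] @ C @ [s] @ B @ [s] @ D)"
    and P: "P \<noteq> []" "hd P = w" "last P = w" and Y: "Y \<noteq> []" "hd Y = y" "last Y = y"
    and s: "s \<in> set P" "s \<in> set Y" "s \<noteq> w" "s \<noteq> y"
  shows "s \<notin> set K" "s \<notin> set L" "single_gap w s P" "single_gap y s Y"
proof -
  have hdP: "w \<in> set A" if "P = A @ s # B" for A B using that P s by (cases A) auto
  have lastP: "w \<in> set B" if "P = A @ s # B" for A B
    using that P s by (cases B rule: rev_cases) auto
  have hdY: "y \<in> set A" if "Y = A @ s # B" for A B using that Y s by (cases A) auto
  have lastY: "y \<in> set B" if "Y = A @ s # B" for A B
    using that Y s by (cases B rule: rev_cases) auto
  obtain P1 P2 where PP: "P = P1 @ s # P2" using s by (meson split_list)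
  obtain Y1 Y2 where YY: "Y = Y1 @ s # Y2" using s by (meson split_list)
  note ends = hdP[OF PP] lastP[OF PP] hdY[OF YY] lastY[OF YY]
  show "s \<notin> set K"
  proof
    assume "s \<in> set K"
    then obtain K1 K2 where "K = K1 @ s # K2" by (meson split_list)
    then have dec: "P @ K @ Y @ L = P1 @ [s] @ (P2 @ K1) @ [s] @ (K2 @ Y1) @ [s] @ (Y2 @ L)"
      using PP YY by simp
    have "subseq [w, y] ((P2 @ K1) @ ([s] @ Y2 @ L))"
      using ends by (intro subseq_pairI) auto
    then show False
      using no[OF dec] subseq_exchange[of w P1 y "K2 @ Y1" "P2 @ K1" s "Y2 @ L"] ends by auto
  qed
  show "s \<notin> set L"
  proof
    assume "s \<in> set L"
    then obtain L1 L2 where "L = L1 @ s # L2" by (meson split_list)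
    then have dec: "P @ K @ Y @ L = P1 @ [s] @ (P2 @ K @ Y1) @ [s] @ (Y2 @ L1) @ [s] @ L2"
      using PP YY by simp
    have "subseq [w, y] (P2 @ (K @ Y1 @ [s] @ L2))"
      using ends by (intro subseq_pairI) auto
    then show False
      using no[OF dec] subseq_exchange[of w P1 y "Y2 @ L1" "P2 @ K @ Y1" s "L2"] ends by auto
  qed
  show "single_gap w s P"
    unfolding single_gap_def
  proof (intro allI impI notI)
    fix A B C assume PA: "P = A @ [s] @ B @ [s] @ C" and "w \<in> set B"
    then have dec: "P @ K @ Y @ L = A @ [s] @ B @ [s] @ (C @ K @ Y1) @ [s] @ (Y2 @ L)"
      using YY by simp
    have "subseq [w, y] (B @ ([s] @ Y2 @ L))"
      using ends \<open>w \<in> set B\<close> by (intro subseq_pairI) auto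
    then show False
      using no[OF dec] subseq_exchange[of w A y "C @ K @ Y1" B s "Y2 @ L"] ends hdP[of A] PA by auto
  qed
  show "single_gap y s Y"
    unfolding single_gap_def
  proof (intro allI impI notI)
    fix A B C assume YA: "Y = A @ [s] @ B @ [s] @ C" and "y \<in> set B"
    then have dec: "P @ K @ Y @ L = P1 @ [s] @ (P2 @ K @ A) @ [s] @ B @ [s] @ (C @ L)"
      using PP by simp
    have "subseq [w, y] (P2 @ (K @ A @ [s] @ C @ L))"
      using ends hdY[of A] YA by (intro subseq_pairI) auto
    then show False
      using no[OF dec] subseq_exchange[of w P1 y B "P2 @ K @ A" s "C @ L"] ends \<open>y \<in> set B\<close> by auto
  qed
qed

text \<open>Appending the first letter closes the word into a cycle. The empty word becomes a list
  of one letter, in which nothing is adjacent.\<close>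

definition cyc_adjacent :: "'a list \<Rightarrow> 'a \<Rightarrow> 'a \<Rightarrow> bool" where
  "cyc_adjacent u a b \<longleftrightarrow> sublist [a, b] (u @ [hd u]) \<or> sublist [b, a] (u @ [hd u])"

lemma cyc_adjacent_sym: "cyc_adjacent u a b \<longleftrightarrow> cyc_adjacent u b a"
  by (auto simp: cyc_adjacent_def)

text \<open>Letters of different blocks are adjacent only across a border, where \<open>P\<close>
  shows \<open>w\<close> and \<open>Y\<close> shows \<open>y\<close>. So a neighbour of
  \<open>w\<close> outside \<open>P\<close> is \<open>y\<close> or an end of \<open>K\<close> or
  \<open>L\<close>; these ends form \<open>M\<close>.\<close>

lemma blocks_adjacent:
  assumes P: "P \<noteq> []" "hd P = w" "last P = w" and Y: "Y \<noteq> []" "hd Y = y" "last Y = y"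
    and sep: "w \<noteq> y" "y \<notin> set P" "w \<notin> set Y" "{w, y} \<inter> (set K \<union> set L) = {}"
  defines "M \<equiv> (if K = [] then {} else {hd K, last K}) \<union> (if L = [] then {} else {hd L, last L})"
  defines "adj \<equiv> cyc_adjacent (P @ K @ Y @ L)"
  shows "adj w y \<Longrightarrow> K = [] \<or> L = []"
    and "adj w s \<Longrightarrow> s \<notin> M \<Longrightarrow> s \<noteq> y \<Longrightarrow> sublist [w, s] P \<or> sublist [s, w] P"
    and "adj y s \<Longrightarrow> s \<notin> M \<Longrightarrow> s \<noteq> w \<Longrightarrow> sublist [y, s] Y \<or> sublist [s, y] Y"
    and "adj s t \<Longrightarrow> {s, t} \<inter> ({w, y} \<union> set K \<union> set L) = {} \<Longrightarrow>
      sublist [s, t] P \<or> sublist [t, s] P \<or> sublist [s, t] Y \<or> sublist [t, s] Y"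
proof -
  have hd: "hd (P @ K @ Y @ L) = w" using P by simp
  have in_set: "a \<in> set xs \<and> b \<in> set xs" if "sublist [a, b] xs" for a b and xs :: "'a list"
    using set_mono_sublist[OF that] by auto
  have w: "w \<notin> set K" "w \<notin> set L" and y: "y \<notin> set K" "y \<notin> set L"
    using sep by blast+
  have hdKY: "hd (K @ Y) = (if K = [] then y else hd K)" and hdLw: "hd (L @ [w]) = (if L = [] then w else hd L)"
    using Y by simp_all
  have sub: "sublist [a, b] P \<or> sublist [a, b] K \<or> sublist [a, b] Y \<or> sublist [a, b] L \<or>
     (a = w \<and> b = (if K = [] then y else hd K)) \<or> (K \<noteq> [] \<and> a = last K \<and> b = y) \<or>
     (a = y \<and> b = (if L = [] then w else hd L)) \<or> (L \<noteq> [] \<and> a = last L \<and> b = w)"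
    if "sublist [a, b] (P @ K @ Y @ L @ [w])" for a b
  proof -
    have "\<not> sublist [a, b] [w]" by (simp add: sublist_Cons_right prefix_def)
    then show ?thesis
      using that P Y unfolding sublist_pair_append by (cases "K = []"; cases "L = []") auto
  qed
  have adjD: "sublist [a, b] (P @ K @ Y @ L @ [w]) \<or> sublist [b, a] (P @ K @ Y @ L @ [w])"
    if "adj a b" for a b using that unfolding adj_def cyc_adjacent_def hd append_assoc .
  have hdl: "K \<noteq> [] \<Longrightarrow> hd K \<in> set K \<and> last K \<in> set K" "L \<noteq> [] \<Longrightarrow> hd L \<in> set L \<and> last L \<in> set L"
    by auto
  note notin = in_set[of _ _ P] in_set[of _ _ K] in_set[of _ _ Y] in_set[of _ _ L]
  show "adj w y \<Longrightarrow> K = [] \<or> L = []"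
    using adjD[of w y] sub[of w y] sub[of y w] notin[of w y] notin[of y w] w y sep hdl
    by (cases "K = []"; cases "L = []") auto
  show "adj w s \<Longrightarrow> s \<notin> M \<Longrightarrow> s \<noteq> y \<Longrightarrow> sublist [w, s] P \<or> sublist [s, w] P"
    using adjD[of w s] sub[of w s] sub[of s w] notin[of w s] notin[of s w] w y sep hdl
    unfolding M_def by (cases "K = []"; cases "L = []") auto
  show "adj y s \<Longrightarrow> s \<notin> M \<Longrightarrow> s \<noteq> w \<Longrightarrow> sublist [y, s] Y \<or> sublist [s, y] Y"
    using adjD[of y s] sub[of y s] sub[of s y] notin[of y s] notin[of s y] w y sep hdl
    unfolding M_def by (cases "K = []"; cases "L = []") auto
  show "adj s t \<Longrightarrow> {s, t} \<inter> ({w, y} \<union> set K \<union> set L) = {} \<Longrightarrow>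
      sublist [s, t] P \<or> sublist [t, s] P \<or> sublist [s, t] Y \<or> sublist [t, s] Y"
    using adjD[of s t] sub[of s t] sub[of t s] notin[of t s] notin[of s t] hdl
    by (cases "K = []"; cases "L = []") auto
qed

section \<open>Interlacing two letters after at most one exchange\<close>

text \<open>Greedy choice: each chosen vertex rules out itself and at most \<open>q\<close>
  others.\<close>

lemma clique_of_three:
  assumes fin: "finite S" and card: "card S \<ge> 3 * q + 3"
    and deg: "\<And>v. v \<in> S \<Longrightarrow> card {x \<in> S. x \<noteq> v \<and> \<not> R v x} \<le> q"
  obtains a b c where "a \<in> S" "b \<in> S" "c \<in> S" "distinct [a, b, c]" "R a b" "R a c" "R b c"
proof -
  have step: "card {x \<in> U. x \<noteq> v \<and> R v x} + 1 + q \<ge> card U" if "U \<subseteq> S" "v \<in> S" for U v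
  proof -
    have "U \<subseteq> {x \<in> U. x \<noteq> v \<and> R v x} \<union> {v} \<union> {x \<in> S. x \<noteq> v \<and> \<not> R v x}" using that by auto
    then have "card U \<le> card ({x \<in> U. x \<noteq> v \<and> R v x} \<union> {v} \<union> {x \<in> S. x \<noteq> v \<and> \<not> R v x})"
      using fin that by (intro card_mono) (auto intro: finite_subset)
    also have "\<dots> \<le> card {x \<in> U. x \<noteq> v \<and> R v x} + 1 + card {x \<in> S. x \<noteq> v \<and> \<not> R v x}"
      by (intro order_trans[OF card_Un_le] add_mono) auto
    finally show ?thesis using deg[OF that(2)] by linarith
  qed
  obtain a where a: "a \<in> S" using card by fastforce
  let ?A = "{x \<in> S. x \<noteq> a \<and> R a x}"
  have "card ?A \<ge> 2 * q + 2" using step[of S a] a card by simp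
  then have "?A \<noteq> {}" by (metis card.empty add_is_0 le_zero_eq zero_neq_numeral)
  then obtain b where b: "b \<in> ?A" by auto
  let ?B = "{x \<in> ?A. x \<noteq> b \<and> R b x}"
  have "card ?B \<ge> 1" using step[of ?A b] b \<open>card ?A \<ge> 2 * q + 2\<close> by simp
  then have "?B \<noteq> {}" by (metis card.empty not_one_le_zero)
  then obtain c where "c \<in> ?B" by auto
  then show ?thesis using a b that[of a b c] by auto
qed

lemma cyc_adjacent_rotate: "cyc_adjacent (rotate k u) a b \<longleftrightarrow> cyc_adjacent u a b"
proof (induction k)
  case (Suc k)
  have "sublist [a, b] (rotate1 v @ [hd (rotate1 v)]) \<longleftrightarrow> sublist [a, b] (v @ [hd v])" for v :: "'a list" and a b
  proof (cases v)
    case (Cons x v')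
    have two: "sublist [a, b] [x, z] \<longleftrightarrow> a = x \<and> b = z" "\<not> sublist [a, b] [x]" for z
      by (auto simp: sublist_Cons_right prefix_def)
    show ?thesis
    proof (cases v')
      case Nil
      then show ?thesis using Cons by simp
    next
      case v': (Cons z v'')
      have "sublist [a, b] (v' @ [x, z]) \<longleftrightarrow> sublist [a, b] ([x] @ v' @ [x])"
        unfolding sublist_pair_append[of a b v'] sublist_pair_append[of a b "[x]"] 
        by (auto simp: v' two)
      then show ?thesis using Cons v' by simp
    qed
  qed simp
  then show ?case using Suc by (simp add: cyc_adjacent_def)
qed simp

text \<open>\<open>q\<close> bounds the number of non-neighbours. Of \<open>5 * q + 7\<close>
  letters at most \<open>2 * q + 4\<close> are lost: \<open>w\<close>, \<open>y\<close>, their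
  non-neighbours and the ends of \<open>K\<close> and \<open>L\<close>. The remaining
  \<open>3 * q + 3\<close> are what \<open>clique_of_three\<close> asks for.\<close>

theorem interlaced_after_exchange:
  assumes u: "set u = V" and wy: "w \<in> V" "y \<in> V" "w \<noteq> y"
    and q: "5 * q + 7 \<le> card V"
    and deg: "\<And>v. v \<in> V \<Longrightarrow> card {x \<in> V. x \<noteq> v \<and> \<not> cyc_adjacent u v x} \<le> q"
  shows "(\<exists>k. subseq [w, y, w, y] (rotate k u)) \<or>
    (\<exists>k A B C D s. rotate k u = A @ [s] @ B @ [s] @ C @ [s] @ D \<and>
       subseq [w, y, w, y] (A @ [s] @ C @ [s] @ B @ [s] @ D))"
proof (rule ccontr)
  assume no: "\<not> ?thesis"
  have no1: "\<And>k. \<not> subseq [w, y, w, y] (rotate k u)"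
    and no2: "\<And>k A B C D s. rotate k u = A @ [s] @ B @ [s] @ C @ [s] @ D \<Longrightarrow>
       \<not> subseq [w, y, w, y] (A @ [s] @ C @ [s] @ B @ [s] @ D)"
    using no unfolding de_Morgan_disj by blast+
  have "w \<in> set u" "y \<in> set u" using u wy by auto
  then obtain k P K Y L where k: "rotate k u = P @ K @ Y @ L"
    and P: "P \<noteq> []" "hd P = w" "last P = w" and yP: "y \<notin> set P"
    and Y: "Y \<noteq> []" "hd Y = y" "last Y = y" and wY: "w \<notin> set Y"
    and KL: "{w, y} \<inter> (set K \<union> set L) = {}"
    by (rule not_interlaced_blocks[OF _ _ wy(3) no1])
  note sep = yP wY KL
  define M where
    "M = (if K = [] then {} else {hd K, last K}) \<union> (if L = [] then {} else {hd L, last L})"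
  define adj where "adj = cyc_adjacent u"
  have adj: "adj = cyc_adjacent (P @ K @ Y @ L)"
    unfolding adj_def k[symmetric] by (simp add: fun_eq_iff cyc_adjacent_rotate)
  note blocks = blocks_adjacent[OF P Y wy(3) sep, folded M_def adj]
  have noex: "\<not> subseq [w, y, w, y] (A @ [s] @ C @ [s] @ B @ [s] @ D)"
    if "P @ K @ Y @ L = A @ [s] @ B @ [s] @ C @ [s] @ D" for A B C D s
    using no2 k that by metis
  have finV: "finite V" using u by auto
  define N where "N v = {x \<in> V. x \<noteq> v \<and> \<not> adj v x}" for v
  have N: "finite (N v)" "v \<in> V \<Longrightarrow> card (N v) \<le> q" for v
    using finV deg by (auto simp: N_def adj_def)
  \<comment> \<open>The common neighbours of \<open>w\<close> and \<open>y\<close> away from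
    \<open>M\<close>: each of them stands next to a \<open>w\<close> in \<open>P\<close> and next to
    a \<open>y\<close> in \<open>Y\<close>.\<close>
  define S where "S = V - ({w, y} \<union> N w \<union> N y \<union> M)"
  \<comment> \<open>Adjacent \<open>w\<close>, \<open>y\<close> leave only two ends in \<open>M\<close>; nonadjacent ones are non-neighbours of each other,
      so they need not be counted separately.\<close>
  have "card ({w, y} \<union> N w \<union> N y \<union> M) \<le> 2 * q + 4"
  proof (cases "adj w y")
    case True
    then have "card M \<le> 2"
      using blocks(1) by (auto simp: M_def card_insert_if)
    then show ?thesis
      using N(2)[OF wy(1)] N(2)[OF wy(2)] card_Un_le[of "{w, y} \<union> N w \<union> N y" M]
        card_Un_le[of "{w, y} \<union> N w" "N y"] card_Un_le[of "{w, y}" "N w"] wy(3) by simp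
  next
    case False
    then have "y \<in> N w" "w \<in> N y"
      using wy cyc_adjacent_sym[of u w y] by (auto simp: N_def adj_def)
    then have "{w, y} \<union> N w \<union> N y \<union> M = (N w \<union> N y) \<union> M" by auto
    moreover have "card M \<le> 4"
      unfolding M_def by (intro order_trans[OF card_Un_le]) (auto simp: card_insert_if)
    ultimately show ?thesis
      using N(2)[OF wy(1)] N(2)[OF wy(2)] card_Un_le[of "N w \<union> N y" M]
        card_Un_le[of "N w" "N y"] by simp
  qed
  moreover have "finite ({w, y} \<union> N w \<union> N y \<union> M)" using N(1) by (simp add: M_def)
  ultimately have "card S \<ge> 3 * q + 3"
    unfolding S_def using q diff_card_le_card_Diff[of "{w, y} \<union> N w \<union> N y \<union> M" V] by linarith
  moreover have "card {x \<in> S. x \<noteq> v \<and> \<not> adj v x} \<le> q" if "v \<in> S" for v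
  proof -
    have "{x \<in> S. x \<noteq> v \<and> \<not> adj v x} \<subseteq> N v" by (auto simp: S_def N_def)
    then have "card {x \<in> S. x \<noteq> v \<and> \<not> adj v x} \<le> card (N v)" using N(1) by (rule card_mono[rotated])
    also have "\<dots> \<le> q" using N(2) that by (simp add: S_def)
    finally show ?thesis .
  qed
  moreover have "finite S" using finV by (simp add: S_def)
  ultimately obtain a b c where abc: "a \<in> S" "b \<in> S" "c \<in> S" "distinct [a, b, c]"
    and adjs: "adj a b" "adj a c" "adj b c"
    using clique_of_three[of S q adj] by blast
  have S: "s \<noteq> w" "s \<noteq> y" "s \<notin> set K" "s \<notin> set L" "single_gap w s P" "single_gap y s Y"
    "sublist [w, s] P \<or> sublist [s, w] P" "sublist [y, s] Y \<or> sublist [s, y] Y"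
    if "s \<in> S" for s
  proof -
    show sw: "s \<noteq> w" "s \<noteq> y" using that by (auto simp: S_def)
    have "adj w s" "adj y s" "s \<notin> M" using that by (auto simp: S_def N_def)
    then show at: "sublist [w, s] P \<or> sublist [s, w] P" "sublist [y, s] Y \<or> sublist [s, y] Y"
      using blocks(2,3) sw by blast+
    then have "s \<in> set P" "s \<in> set Y" unfolding sublist_pair_iff by auto
    then show "s \<notin> set K" "s \<notin> set L" "single_gap w s P" "single_gap y s Y"
      using blocks_no_exchange[OF noex P Y _ _ sw] by blast+
  qed
  \<comment> \<open>No letter of \<open>S\<close> occurs in \<open>K\<close> or \<open>L\<close>, so
    two adjacent ones are adjacent inside \<open>P\<close> or inside \<open>Y\<close>.\<close>
  have share: "(sublist [s, t] P \<or> sublist [t, s] P) \<or> (sublist [s, t] Y \<or> sublist [t, s] Y)"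
    if "adj s t" "s \<in> S" "t \<in> S" for s t
    using blocks(4)[OF that(1)] S[OF that(2)] S[OF that(3)] by auto
  have forkP: False if mem: "r \<in> S" "s \<in> S" "t \<in> S" and "distinct [r, s, t]"
    "sublist [r, s] P \<or> sublist [s, r] P" "sublist [r, t] P \<or> sublist [t, r] P" for r s t
  proof (rule single_gap_no_fork[OF _ _ that(5,6,4)])
    fix x assume "x \<in> {r, s, t}"
    then have "x \<in> S" using mem by blast
    then show "single_gap w x P \<and> x \<noteq> w" "sublist [w, x] P \<or> sublist [x, w] P"
      using S by blast+
  qed
  have forkY: False if mem: "r \<in> S" "s \<in> S" "t \<in> S" and "distinct [r, s, t]"
    "sublist [r, s] Y \<or> sublist [s, r] Y" "sublist [r, t] Y \<or> sublist [t, r] Y" for r s t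
  proof (rule single_gap_no_fork[OF _ _ that(5,6,4)])
    fix x assume "x \<in> {r, s, t}"
    then have "x \<in> S" using mem by blast
    then show "single_gap y x Y \<and> x \<noteq> y" "sublist [y, x] Y \<or> sublist [x, y] Y"
      using S by blast+
  qed
  have "distinct [b, a, c]" "distinct [c, a, b]" using abc by auto
  \<comment> \<open>Two of the three edges of the triangle lie in the same block. Any two edges of a
    triangle meet in a vertex, so they form a fork.\<close>
  then show False
    using share[OF adjs(1) abc(1,2)] share[OF adjs(2) abc(1,3)] share[OF adjs(3) abc(2,3)]
      forkP[of a b c] forkP[of b a c] forkP[of c a b] forkY[of a b c] forkY[of b a c] forkY[of c a b] abc
    by blast
qed

section \<open>Cycles, orbits and signs of permutations\<close>

lemma cycle_of_list_nth:
  assumes "distinct p" "k < length p"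
  shows "cycle_of_list p (p ! k) = p ! (Suc k mod length p)"
proof -
  have "map (cycle_of_list p) p ! k = rotate1 p ! k"
    using cyclic_rotation[OF assms(1), of 1] by simp
  then show ?thesis using assms(2) by (simp add: nth_rotate1)
qed

lemma cycle_of_list_last:
  assumes "distinct p" "p \<noteq> []"
  shows "cycle_of_list p (last p) = hd p"
  using cycle_of_list_nth[OF assms(1), of "length p - 1"] assms(2)
  by (simp add: last_conv_nth hd_conv_nth)

lemma cycle_of_list_next:
  assumes "distinct (A @ a # b # B)"
  shows "cycle_of_list (A @ a # b # B) a = b"
  using cycle_of_list_nth[OF assms, of "length A"] by (simp add: nth_append)

lemma split_at_not_last:
  assumes "x \<in> set p" "x \<noteq> last p"
  obtains A b B where "p = A @ x # b # B"
proof -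
  obtain A B where p: "p = A @ x # B" using assms(1) by (meson split_list)
  with assms(2) have "B \<noteq> []" by auto
  then show ?thesis using that[of A "hd B" "tl B"] p by simp
qed

text \<open>The transposition interchanges the successors of \<open>last p\<close> and
  \<open>last q\<close>, so that \<open>last p\<close> returns to \<open>hd p\<close> and
  \<open>last q\<close> to \<open>hd q\<close>.\<close>

lemma cycle_of_list_split:
  assumes d: "distinct (p @ q)" and ne: "p \<noteq> []" "q \<noteq> []"
  shows "cycle_of_list (p @ q) \<circ> transpose (last p) (last q) = cycle_of_list p \<circ> cycle_of_list q"
proof
  fix x
  have dis: "distinct p" "distinct q" "set p \<inter> set q = {}" using d by auto
  have lasts: "last p \<in> set p" "last q \<in> set q" "last p \<noteq> last q"
    using ne dis by simp_all (metis disjoint_iff last_in_set)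
  have next_p: "cycle_of_list (p @ q) (last p) = hd q"
  proof -
    have "p @ q = butlast p @ last p # hd q # tl q" using ne by simp
    then show ?thesis using d cycle_of_list_next by metis
  qed
  consider "x \<notin> set p \<union> set q" | "x = last p" | "x = last q"
    | "x \<in> set p" "x \<noteq> last p" | "x \<in> set q" "x \<noteq> last q" by auto
  then show "(cycle_of_list (p @ q) \<circ> transpose (last p) (last q)) x = (cycle_of_list p \<circ> cycle_of_list q) x"
  proof cases
    case 1
    then have "x \<noteq> last p" "x \<noteq> last q" using lasts by auto
    then show ?thesis using 1 by (simp add: id_outside_supp)
  next
    case 2
    then have "x \<notin> set q" using lasts dis by auto
    then show ?thesis using 2 cycle_of_list_last[OF d] cycle_of_list_last[OF dis(1)] ne
      by (simp add: id_outside_supp)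
  next
    case 3
    have "hd q \<notin> set p" using dis ne hd_in_set by blast
    then show ?thesis using 3 next_p cycle_of_list_last[OF dis(2)] ne
      by (simp add: id_outside_supp)
  next
    case 4
    then obtain A b B where p: "p = A @ x # b # B" by (rule split_at_not_last)
    have "x \<notin> set q" "x \<noteq> last q" using 4 dis lasts by auto
    moreover have "cycle_of_list p x = b" using cycle_of_list_next p dis by metis
    moreover have "cycle_of_list (p @ q) x = b"
      using cycle_of_list_next[of A x b "B @ q"] d p by simp
    ultimately show ?thesis using 4 by (simp add: id_outside_supp)
  next
    case 5
    then obtain A b B where q: "q = A @ x # b # B" by (rule split_at_not_last)
    have "x \<noteq> last p" "b \<notin> set p" using 5 q dis lasts by auto
    moreover have "cycle_of_list q x = b" using cycle_of_list_next q dis by metis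
    moreover have "cycle_of_list (p @ q) x = b"
      using cycle_of_list_next[of "p @ A" x b B] d q by simp
    ultimately show ?thesis using 5 by (simp add: id_outside_supp)
  qed
qed

lemma cycle_of_list_merge:
  assumes "distinct (p @ q)" "p \<noteq> []" "q \<noteq> []"
  shows "cycle_of_list p \<circ> cycle_of_list q \<circ> transpose (last p) (last q) = cycle_of_list (p @ q)"
  unfolding cycle_of_list_split[OF assms, symmetric] by (simp add: comp_assoc)

lemma cycle_of_list_append_commute:
  assumes "distinct (p @ q)"
  shows "cycle_of_list (p @ q) = cycle_of_list (q @ p)"
  using cycle_of_list_rotate_independent[OF assms, of "length p"] by (simp add: rotate_append)

text \<open>The first transposition splits \<open>Z\<close> off and the second inserts it again
  behind \<open>X\<close>. Together they form a 3-cycle on the three last elements.\<close>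

lemma cycle_of_list_exchange3:
  assumes d: "distinct (X @ Y @ Z)" and ne: "X \<noteq> []" "Y \<noteq> []" "Z \<noteq> []"
  shows "cycle_of_list (X @ Z @ Y) =
    cycle_of_list (X @ Y @ Z) \<circ> transpose (last Y) (last Z) \<circ> transpose (last X) (last Z)"
proof -
  have "cycle_of_list (X @ Y @ Z) \<circ> transpose (last Y) (last Z) = cycle_of_list (X @ Y) \<circ> cycle_of_list Z"
    using cycle_of_list_split[of "X @ Y" Z] d ne by simp
  also have "\<dots> = cycle_of_list (Y @ X) \<circ> cycle_of_list Z"
    using cycle_of_list_append_commute[of X Y] d by (simp add: Int_Un_distrib)
  finally show ?thesis
    using cycle_of_list_merge[of "Y @ X" Z] cycle_of_list_append_commute[of Y "X @ Z"] d ne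
    by (simp add: comp_assoc Int_commute Int_Un_distrib Int_Un_distrib2)
qed

text \<open>The first transposition cuts the cycle into \<open>W @ X\<close> and
  \<open>Y @ Z\<close>. The second takes one point from each part, because the two pairs interlace,
  and joins the parts again.\<close>

lemma cycle_of_list_exchange4:
  assumes d: "distinct (X @ Y @ Z @ W)" and ne: "X \<noteq> []" "Y \<noteq> []" "Z \<noteq> []" "W \<noteq> []"
  shows "cycle_of_list (X @ W @ Z @ Y) =
    cycle_of_list (X @ Y @ Z @ W) \<circ> transpose (last X) (last Z) \<circ> transpose (last Y) (last W)"
proof -
  have d': "distinct ((X @ W) @ (Z @ Y))" "distinct ((W @ X) @ (Y @ Z))" "distinct (X @ W)" "distinct (Y @ Z)"
    "distinct ((X @ Y @ Z) @ W)"
    using d by auto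
  have "cycle_of_list (X @ Y @ Z @ W) = cycle_of_list ((W @ X) @ (Y @ Z))"
    using cycle_of_list_append_commute[OF d'(5)] by simp
  then have "cycle_of_list (X @ Y @ Z @ W) \<circ> transpose (last X) (last Z)
      = cycle_of_list (W @ X) \<circ> cycle_of_list (Y @ Z)"
    using cycle_of_list_split[OF d'(2)] ne by simp
  also have "\<dots> = cycle_of_list (X @ W) \<circ> cycle_of_list (Z @ Y)"
    using cycle_of_list_append_commute[OF d'(3)] cycle_of_list_append_commute[OF d'(4)] by simp
  finally show ?thesis
    using cycle_of_list_merge[OF d'(1)] ne by (simp add: transpose_commute)
qed

section \<open>Signs of cyclic and of block-preserving permutations\<close>

lemma sign_cycle_of_list:
  assumes "distinct p"
  shows "sign (cycle_of_list p) = (- 1) ^ (length p - 1)"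
  using assms
proof (induction p rule: cycle_of_list.induct)
  case (1 i j cs)
  then show ?case
    unfolding cycle_of_list.simps sign_compose[OF permutation_swap_id permutation_of_cycle]
    by (simp add: sign_swap_id)
qed simp_all

text \<open>Only the values of \<open>f\<close> on \<open>p\<close> enter, so this applies to a
  single cycle of a product of disjoint cycles. By distinctness the iterates first return after
  \<open>length p\<close> steps.\<close>

lemma support_along_list:
  assumes d: "distinct p" and f: "\<And>k. k < length p \<Longrightarrow> f (p ! k) = p ! (Suc k mod length p)"
    and i: "i < length p"
  shows "support f (p ! i) = rotate i p"
proof -
  let ?n = "length p"
  have pow: "(f ^^ j) (p ! i) = p ! ((i + j) mod ?n)" for j
  proof (induction j)
    case (Suc j)
    have "(i + j) mod ?n < ?n" using i by (intro mod_less_divisor) linarith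
    then show ?case using Suc f by (simp add: mod_Suc_eq)
  qed (use i in simp)
  have "(f ^^ j) (p ! i) \<noteq> p ! i" if "0 < j" "j < ?n" for j
  proof
    assume "(f ^^ j) (p ! i) = p ! i"
    moreover have "(i + j) mod ?n < ?n" using i by (intro mod_less_divisor) linarith
    ultimately have "(i + j) mod ?n = i"
      using pow d i nth_eq_iff_index_eq[of p "(i + j) mod ?n" i] by simp
    then show False using that i by (cases "i + j < ?n") (auto simp: le_mod_geq)
  qed
  moreover have "(f ^^ ?n) (p ! i) = p ! i" using pow i by simp
  ultimately have "least_power f (p ! i) = ?n"
    unfolding least_power_def using i by (intro Least_equality) (auto simp: not_less[symmetric])
  then show ?thesis
    by (intro nth_equalityI) (auto simp: pow nth_rotate add.commute)
qed

lemma perm_restrict_permutes: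
  assumes "c permutes A" "finite S" "c ` S \<subseteq> S"
  shows "perm_restrict c S permutes S"
proof (rule bij_imp_permutes)
  have "inj_on c S" using permutes_inj[OF assms(1)] inj_on_subset by blast
  then have "bij_betw c S S"
    using endo_inj_surj[OF assms(2,3)] by (simp add: bij_betw_def)
  then show "bij_betw (perm_restrict c S) S S"
    by (rule bij_betw_cong[THEN iffD1, rotated]) (simp add: perm_restrict_simps)
qed (simp add: perm_restrict_simps)

lemma permutes_eq_cycle_of_list_support:
  assumes "g permutes S" "finite S" "x \<in> S" "S \<subseteq> set (support g x)"
  shows "g = cycle_of_list (support g x)" "set (support g x) = S"
proof -
  have p: "permutation g" using assms by (auto simp: permutation_permutes)
  have "(g ^^ i) x \<in> S" for i
    using assms(1,3) permutes_funpow permutes_in_image by metis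
  then show set: "set (support g x) = S" using assms(4) support_set[OF p, of x] by auto
  show "g = cycle_of_list (support g x)"
  proof
    fix y show "g y = cycle_of_list (support g x) y"
    proof (cases "y \<in> S")
      case True
      then show ?thesis using cycle_restrict[OF p] set by blast
    next
      case False
      then show ?thesis
        using permutes_not_in[OF assms(1)] id_outside_supp[of y "support g x"] set by simp
    qed
  qed
qed

lemma sign_cyclic:
  assumes "g permutes S" "finite S" "S \<subseteq> set (support g x)" "x \<in> S"
  shows "sign g = (- 1) ^ (card S - 1)"
proof -
  have p: "permutation g" using assms by (auto simp: permutation_permutes)
  note g = permutes_eq_cycle_of_list_support[OF assms(1,2,4,3)]
  have "sign (cycle_of_list (support g x)) = (- 1) ^ (length (support g x) - 1)"
    using sign_cycle_of_list[OF cycle_of_permutation[OF p]] .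
  then show ?thesis
    using g distinct_card[OF cycle_of_permutation[OF p, of x]] by metis
qed

lemma sign_perm_restrict_cyclic:
  assumes "c permutes A" "cyclic_on c S"
  shows "sign (perm_restrict c S) = (- 1) ^ (card S - 1)"
proof -
  have fin: "finite S" using assms(2) by (rule finite_cyclic_on)
  have perm: "perm_restrict c S permutes S"
    using assms fin cyclic_on_inI by (intro perm_restrict_permutes) auto
  then have p: "permutation (perm_restrict c S)" using fin by (auto simp: permutation_permutes)
  have cyc: "cyclic_on (perm_restrict c S) S" using assms(2) by (simp add: cyclic_on_perm_restrict)
  then obtain x where x: "x \<in> S" "S = orbit (perm_restrict c S) x" unfolding cyclic_on_def by auto
  then have "S = set (support (perm_restrict c S) x)"
    unfolding support_set[OF p] using orbit_altdef_permutation[OF p, of x] by (simp add: full_SetCompr_eq)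
  then show ?thesis using sign_cyclic[OF perm fin _ x(1)] by simp
qed

text \<open>\<open>c\<close> maps each fibre of \<open>h\<close> to itself, so it is the product of
  its restrictions to the fibres, whose supports are disjoint.\<close>

lemma sign_eq_prod_blocks:
  assumes c: "c permutes A" and fin: "finite A" "finite V"
    and h: "\<And>a. a \<in> A \<Longrightarrow> h (c a) = h a" "h ` A \<subseteq> V"
  shows "sign c = (\<Prod>v\<in>V. sign (perm_restrict c {a \<in> A. h a = v}))"
proof -
  have perm: "perm_restrict c {a \<in> A. h a \<in> W} permutes {a \<in> A. h a \<in> W}" for W
    using c fin h permutes_in_image[OF c] by (intro perm_restrict_permutes) auto
  have "sign (perm_restrict c {a \<in> A. h a \<in> W}) = (\<Prod>v\<in>W. sign (perm_restrict c {a \<in> A. h a = v}))"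
    if "finite W" for W
    using that
  proof (induction W)
    case empty
    have "perm_restrict c {} = id" by (auto simp: perm_restrict_def)
    then show ?case by simp
  next
    case (insert v W)
    have p: "perm_restrict c {a \<in> A. h a = v} permutes {a \<in> A. h a = v}" using perm[of "{v}"] by simp
    have disj: "{a \<in> A. h a = v} \<inter> {a \<in> A. h a \<in> W} = {}" using insert.hyps by auto
    have "{a \<in> A. h a \<in> insert v W} = {a \<in> A. h a = v} \<union> {a \<in> A. h a \<in> W}" by auto
    then have "perm_restrict c {a \<in> A. h a \<in> insert v W}
        = perm_restrict c {a \<in> A. h a = v} \<circ> perm_restrict c {a \<in> A. h a \<in> W}"
      using perm_restrict_union[OF p perm[of W] disj] by (simp only:)
    moreover have "permutation (perm_restrict c {a \<in> A. h a = v})"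
      "permutation (perm_restrict c {a \<in> A. h a \<in> W})"
      using p perm[of W] fin(1) by (auto intro: permutes_imp_permutation[rotated])
    ultimately have "sign (perm_restrict c {a \<in> A. h a \<in> insert v W})
        = sign (perm_restrict c {a \<in> A. h a = v}) * sign (perm_restrict c {a \<in> A. h a \<in> W})"
      by (simp only: sign_compose)
    then show ?case using insert by simp
  qed
  from this[OF fin(2)] have "sign (perm_restrict c {a \<in> A. h a \<in> V}) = (\<Prod>v\<in>V. sign (perm_restrict c {a \<in> A. h a = v}))" .
  moreover have "{a \<in> A. h a \<in> V} = A" using h by auto
  ultimately show ?thesis using c by simp
qed

section \<open>Merging orbits with a transposition\<close>

text \<open>From \<open>y\<close> the new permutation moves to \<open>c x\<close> and then follows
  the old orbit of \<open>x\<close>. As \<open>y\<close> is not met there, nothing changes before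
  \<open>x\<close> is reached.\<close>

lemma orbit_transpose_subset:
  assumes c: "permutation c" and y: "y \<notin> orbit c x" and z: "z \<in> orbit c x"
  shows "z \<in> orbit (c \<circ> transpose x y) y"
  using z
proof (induction rule: orbit.induct)
  case base
  have "(c \<circ> transpose x y) y = c x" by simp
  then show ?case by (metis orbit.base)
next
  case (step z)
  show ?case
  proof (cases "z = x")
    case True
    have "(c \<circ> transpose x y) y = c x" by simp
    then show ?thesis using True by (metis orbit.base)
  next
    case False
    moreover have "z \<noteq> y" using step.hyps y by blast
    ultimately have "(c \<circ> transpose x y) z = c z" by simp
    then show ?thesis using step by (metis orbit.step)
  qed
qed

lemma orbit_disjoint:
  assumes "permutation c" "y \<notin> orbit c x"
  shows "x \<notin> orbit c y"
  using assms by (metis orbit_swap permutation_self_in_orbit)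

text \<open>By \<open>orbit_transpose_subset\<close> in both directions, \<open>x\<close> and
  \<open>y\<close> lie in each other's new orbits. Orbits avoiding both points stay as they
  were.\<close>

lemma orbit_transpose_merge:
  assumes c: "permutation c" and y: "y \<notin> orbit c x"
  shows "orbit (c \<circ> transpose x y) x = orbit c x \<union> orbit c y"
    and "orbit (c \<circ> transpose x y) y = orbit c x \<union> orbit c y"
    and "z \<notin> orbit c x \<union> orbit c y \<Longrightarrow> orbit (c \<circ> transpose x y) z = orbit c z"
proof -
  let ?c = "c \<circ> transpose x y"
  have c': "permutation ?c" using c by (simp add: permutation_compose permutation_swap_id)
  have x: "x \<notin> orbit c y" using orbit_disjoint[OF c y] .
  note self = permutation_self_in_orbit[OF c]
  have xy: "orbit c x \<subseteq> orbit ?c y" using orbit_transpose_subset[OF c y] by blast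
  have yx: "orbit c y \<subseteq> orbit ?c x"
    using orbit_transpose_subset[OF c x] by (metis subsetI transpose_commute)
  have "x \<in> orbit ?c y" "y \<in> orbit ?c x" using xy yx self by blast+
  then have eq: "orbit ?c x = orbit ?c y" by (auto intro: orbit_trans)
  have sub: "orbit ?c x \<subseteq> orbit c x \<union> orbit c y"
  proof
    fix z assume "z \<in> orbit ?c x"
    then show "z \<in> orbit c x \<union> orbit c y"
    proof induction
      case base
      then show ?case by (simp add: orbit.base)
    next
      case (step z)
      then show ?case using self
        by (cases "z = x"; cases "z = y") (auto intro: orbit.intros)
    qed
  qed
  show "orbit ?c x = orbit c x \<union> orbit c y" using sub xy yx eq by blast
  then show "orbit ?c y = orbit c x \<union> orbit c y" using eq by simp
  show "orbit ?c z = orbit c z" if "z \<notin> orbit c x \<union> orbit c y"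
  proof (rule orbit_cong[OF self])
    fix s assume s: "s \<in> orbit c z"
    then have "s \<noteq> x" "s \<noteq> y" using that self orbit_swap by (metis UnCI)+
    then show "?c s = c s" by simp
  qed
qed

text \<open>The two distinct orbits of \<open>x\<close> and \<open>y\<close> are replaced by their
  union and all others are kept.\<close>

lemma card_orbits_transpose_less:
  assumes c: "permutation c" and fin: "finite A" and xy: "x \<in> A" "y \<in> A" "y \<notin> orbit c x"
  shows "card (orbit (c \<circ> transpose x y) ` A) < card (orbit c ` A)"
proof -
  let ?c = "c \<circ> transpose x y" and ?U = "orbit c x \<union> orbit c y"
  have "orbit ?c z \<in> insert ?U (orbit c ` A - {orbit c x, orbit c y})" if "z \<in> A" for z
  proof (cases "z \<in> ?U")
    case True
    have "permutation ?c" using c by (simp add: permutation_compose permutation_swap_id)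
    moreover have "z \<in> orbit ?c x" using True orbit_transpose_merge(1)[OF c xy(3)] by simp
    ultimately have "orbit ?c z = orbit ?c x"
      by (metis cyclic_on_orbit' orbit_cyclic_eq3)
    then show ?thesis using orbit_transpose_merge(1)[OF c xy(3)] by simp
  next
    case False
    then have "orbit c z \<noteq> orbit c x" "orbit c z \<noteq> orbit c y"
      using permutation_self_in_orbit[OF c, of z] by auto
    then show ?thesis using orbit_transpose_merge(3)[OF c xy(3) False] that by auto
  qed
  then have "card (orbit ?c ` A) \<le> card (insert ?U (orbit c ` A - {orbit c x, orbit c y}))"
    using fin by (intro card_mono) auto
  also have "\<dots> \<le> Suc (card (orbit c ` A - {orbit c x, orbit c y}))"
    by (rule card_insert_le_m1) auto
  also have "\<dots> < card (orbit c ` A)"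
  proof -
    have ne: "orbit c x \<noteq> orbit c y" using xy(3) permutation_self_in_orbit[OF c, of y] by auto
    have sub: "{orbit c x, orbit c y} \<subseteq> orbit c ` A" using xy by auto
    have "card (orbit c ` A - {orbit c x, orbit c y}) = card (orbit c ` A) - 2"
      using ne sub by (simp add: card_Diff_subset)
    moreover have "card (orbit c ` A) \<ge> 2" using card_mono[OF _ sub] fin ne by simp
    ultimately show ?thesis by linarith
  qed
  finally show ?thesis .
qed

section \<open>Circuits and their exchanges\<close>

lemma subseq_map_ConsE:
  assumes "subseq (v # vs) (map h p)"
  obtains X a Y where "p = X @ a # Y" "h a = v" "subseq vs (map h Y)"
proof -
  obtain us u ws where "map h p = us @ u # ws" "v = u" "subseq vs ws"
    using list_emb_ConsD[OF assms] by auto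
  then show ?thesis using that by (auto simp: map_eq_append_conv map_eq_Cons_conv)
qed

lemma map_eq_append_ConsE:
  assumes "map h r = B @ s # R"
  obtains B' a R' where "r = B' @ a # R'" "map h B' = B" "h a = s" "map h R' = R"
  using assms by (auto simp: map_eq_append_conv map_eq_Cons_conv)

lemma split_list_first_of_set:
  assumes "S \<subseteq> set p" "S \<noteq> {}"
  obtains X a Y where "p = X @ a # Y" "a \<in> S" "S - {a} \<subseteq> set Y"
proof -
  have "\<exists>x\<in>set p. x \<in> S" using assms by auto
  from split_list_first_prop[OF this]
  obtain X a Y where "p = X @ a # Y" "a \<in> S" "\<forall>x\<in>set X. x \<notin> S" by blast
  then show ?thesis using that[of X a Y] assms(1) by auto
qed

section \<open>Tours and vertices of wrong parity\<close>

text \<open>The list \<open>t_arcs\<close> is the given euler circuit and \<open>h\<close> sends an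
  arc to its head; these two data replace the digraph.\<close>

locale circuit =
  fixes t_arcs :: "'b list" and h :: "'b \<Rightarrow> 'a"
  assumes distinct_t: "distinct t_arcs"
begin

abbreviation A :: "'b set" where "A \<equiv> set t_arcs"
abbreviation t :: "'b \<Rightarrow> 'b" where "t \<equiv> cycle_of_list t_arcs"

definition block :: "'a \<Rightarrow> 'b set" where "block v = {a \<in> A. h a = v}"

text \<open>The tail of \<open>b\<close> is \<open>h (inv t b)\<close>, so the last condition says
  that the successor of \<open>a\<close> leaves the head of \<open>a\<close>. Tours are the euler
  circuits of the digraph, as arc lists.\<close>

definition tour :: "'b list \<Rightarrow> bool" where
  "tour p \<longleftrightarrow> distinct p \<and> set p = A \<and> (\<forall>a\<in>A. h (inv t (cycle_of_list p a)) = h a)"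

text \<open>If \<open>t\<close> and \<open>f\<close> are the proface and antiface steps of an embedding, then \<open>twist f\<close> is its
  clockwise rotation restricted to the entering half-arcs.\<close>

definition twist :: "('b \<Rightarrow> 'b) \<Rightarrow> 'b \<Rightarrow> 'b" where
  "twist f = inv t \<circ> f"

text \<open>A permutation of \<open>m\<close> points with \<open>k\<close> cycles has sign
  \<open>(- 1) ^ (m - k)\<close>. For a \<open>c\<close> that preserves the blocks these are the
  vertices at which the number of cycles is even, hence not one.\<close>

definition odd_blocks :: "('b \<Rightarrow> 'b) \<Rightarrow> 'a set" where
  "odd_blocks c = {v \<in> h ` A. sign (perm_restrict c (block v)) \<noteq> (- 1) ^ (card (block v) - 1)}"

lemma finite_block [simp]: "finite (block v)" by (simp add: block_def)

lemma finite_odd_blocks: "finite (odd_blocks c)" by (simp add: odd_blocks_def)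

lemma twist_permutes: "f permutes A \<Longrightarrow> twist f permutes A"
  unfolding twist_def by (intro permutes_compose permutes_inv cycle_permutes)

lemma twist_comp: "twist (f \<circ> g) = twist f \<circ> g"
  by (simp add: twist_def comp_assoc)

lemma tour_permutes: "tour p \<Longrightarrow> cycle_of_list p permutes A"
  using cycle_permutes[of p] by (simp add: tour_def)

lemma tour_twist:
  assumes "tour p"
  shows "twist (cycle_of_list p) permutes A" "\<forall>a\<in>A. h (twist (cycle_of_list p) a) = h a"
  using assms twist_permutes[OF tour_permutes[OF assms]] by (auto simp: twist_def tour_def)

lemma perm_restrict_block_permutes:
  assumes "c permutes A" "\<forall>a\<in>A. h (c a) = h a"
  shows "perm_restrict c (block v) permutes block v"
  using assms permutes_in_image[OF assms(1)]
  by (intro perm_restrict_permutes) (auto simp: block_def)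

lemma perm_restrict_transpose:
  assumes "x \<in> A" "y \<in> A" "h x = h y"
  shows "perm_restrict (c \<circ> transpose x y) (block v) =
    (if v = h x then perm_restrict c (block v) \<circ> transpose x y else perm_restrict c (block v))"
proof
  fix a
  consider "a = x" | "a = y" | "a \<noteq> x" "a \<noteq> y" by blast
  then show "perm_restrict (c \<circ> transpose x y) (block v) a =
    (if v = h x then perm_restrict c (block v) \<circ> transpose x y else perm_restrict c (block v)) a"
    by cases (use assms in \<open>auto simp: perm_restrict_def block_def\<close>)
qed

lemma odd_blocks_transpose:
  assumes c: "c permutes A" "\<forall>a\<in>A. h (c a) = h a"
    and xy: "x \<in> A" "y \<in> A" "h x = h y" "x \<noteq> y"
  shows "odd_blocks (c \<circ> transpose x y) = sym_diff (odd_blocks c) {h x}"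
proof -
  have perm: "permutation (perm_restrict c (block (h x)))"
    by (rule permutes_imp_permutation[OF finite_block perm_restrict_block_permutes[OF c]])
  have "sign (perm_restrict (c \<circ> transpose x y) (block (h x))) = - sign (perm_restrict c (block (h x)))"
    unfolding perm_restrict_transpose[OF xy(1-3)] if_P[OF refl]
      sign_compose[OF perm permutation_swap_id]
    using xy(4) by (simp add: sign_swap_id)
  moreover have "sign (perm_restrict c (block (h x))) = 1 \<or> sign (perm_restrict c (block (h x))) = -1"
    by (cases "perm_restrict c (block (h x))" rule: sign_cases) auto
  moreover have "(- 1 :: int) ^ (card (block (h x)) - 1) = 1 \<or> (- 1 :: int) ^ (card (block (h x)) - 1) = - 1"
    by (simp add: uminus_power_if)
  ultimately have "h x \<in> odd_blocks (c \<circ> transpose x y) \<longleftrightarrow> h x \<notin> odd_blocks c"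
    using xy(1) by (auto simp: odd_blocks_def)
  moreover have "v \<in> odd_blocks (c \<circ> transpose x y) \<longleftrightarrow> v \<in> odd_blocks c" if "v \<noteq> h x" for v
    using that unfolding odd_blocks_def perm_restrict_transpose[OF xy(1-3)] by simp
  ultimately show ?thesis by blast
qed

text \<open>Multiplying \<open>f\<close> on the right multiplies \<open>twist f\<close> on the
  right, so a transposition of the antiface step acts directly on the rotation at one
  vertex.\<close>

lemma twist_transpose:
  assumes "f permutes A" "\<forall>a\<in>A. h (twist f a) = h a"
    and "x \<in> A" "y \<in> A" "h x = h y" "x \<noteq> y"
  shows "f \<circ> transpose x y permutes A"
    "\<forall>a\<in>A. h (twist (f \<circ> transpose x y) a) = h a"
    "odd_blocks (twist (f \<circ> transpose x y)) = sym_diff (odd_blocks (twist f)) {h x}"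
proof -
  show "f \<circ> transpose x y permutes A"
    using assms by (intro permutes_compose permutes_swap_id)
  have "h (twist f (transpose x y a)) = h a" if "a \<in> A" for a
    using assms that by (cases "a = x"; cases "a = y") auto
  then show "\<forall>a\<in>A. h (twist (f \<circ> transpose x y) a) = h a"
    unfolding twist_comp by simp
  show "odd_blocks (twist (f \<circ> transpose x y)) = sym_diff (odd_blocks (twist f)) {h x}"
    unfolding twist_comp using assms by (intro odd_blocks_transpose twist_permutes)
qed

lemma tour_iff:
  "tour p \<longleftrightarrow> distinct p \<and> set p = A \<and> (\<forall>a\<in>A. h (twist (cycle_of_list p) a) = h a)"
  by (simp add: tour_def twist_def)

lemma tour_rotate: "tour p \<Longrightarrow> tour (rotate k p)" "tour p \<Longrightarrow> cycle_of_list (rotate k p) = cycle_of_list p"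
proof -
  assume p: "tour p"
  then show *: "cycle_of_list (rotate k p) = cycle_of_list p"
    using cycle_of_list_rotate_independent[of p k] by (simp add: tour_def)
  show "tour (rotate k p)" using p by (simp add: tour_def *)
qed

text \<open>Both transpositions act at the same vertex, so its parity flips twice.\<close>

lemma tour_exchange3:
  assumes p: "tour (X @ [a] @ Y @ [b] @ Z @ [c] @ W)" and h: "h a = v" "h b = v" "h c = v"
  defines "f \<equiv> cycle_of_list (X @ [a] @ Y @ [b] @ Z @ [c] @ W)"
    and "p' \<equiv> X @ [a] @ Z @ [c] @ Y @ [b] @ W"
  shows "tour p'" "cycle_of_list p' = f \<circ> transpose b c \<circ> transpose a c"
    "odd_blocks (twist (cycle_of_list p')) = odd_blocks (twist f)"
proof -
  \<comment> \<open>Moving \<open>W\<close> to the front makes each of the three segments end with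
    one of the three arcs.\<close>
  let ?X = "W @ X @ [a]" and ?Y = "Y @ [b]" and ?Z = "Z @ [c]"
  have d: "distinct (X @ [a] @ Y @ [b] @ Z @ [c] @ W)" and A: "set (X @ [a] @ Y @ [b] @ Z @ [c] @ W) = A"
    using p by (auto simp: tour_def)
  have "f = cycle_of_list (?X @ ?Y @ ?Z)"
    using cycle_of_list_append_commute[of "X @ [a] @ Y @ [b] @ Z @ [c]" W] d unfolding f_def by simp
  moreover have "cycle_of_list p' = cycle_of_list (?X @ ?Z @ ?Y)"
    using cycle_of_list_append_commute[of "X @ [a] @ Z @ [c] @ Y @ [b]" W] d unfolding p'_def by auto
  moreover have "distinct (?X @ ?Y @ ?Z)" using d by auto
  ultimately show f': "cycle_of_list p' = f \<circ> transpose b c \<circ> transpose a c"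
    using cycle_of_list_exchange3[of ?X ?Y ?Z] by simp
  have abc: "a \<in> A" "b \<in> A" "c \<in> A" "a \<noteq> c" "b \<noteq> c" using A d by auto
  have f: "f permutes A" "\<forall>a\<in>A. h (twist f a) = h a"
    using tour_permutes[OF p] tour_twist[OF p] by (auto simp: f_def)
  have hh: "h b = h c" "h a = h c" using h by auto
  note f1 = twist_transpose[OF f abc(2,3) hh(1) abc(5)]
  note f2 = twist_transpose[OF f1(1,2) abc(1,3) hh(2) abc(4)]
  have "distinct p'" "set p' = A" using d A by (auto simp: p'_def)
  then show "tour p'"
    unfolding tour_iff f' using f2(2) by blast
  show "odd_blocks (twist (cycle_of_list p')) = odd_blocks (twist f)"
    unfolding f' f2(3) f1(3) h by blast
qed

text \<open>One transposition acts at \<open>w\<close> and one at \<open>y\<close>, so both parities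
  flip; the interlaced order keeps the result a single circuit.\<close>

lemma tour_exchange4:
  assumes p: "tour (X @ [a] @ Y @ [b] @ Z @ [c] @ W @ [d] @ R)"
    and h: "h a = w" "h b = y" "h c = w" "h d = y" "w \<noteq> y"
  defines "f \<equiv> cycle_of_list (X @ [a] @ Y @ [b] @ Z @ [c] @ W @ [d] @ R)"
    and "p' \<equiv> X @ [a] @ W @ [d] @ Z @ [c] @ Y @ [b] @ R"
  shows "tour p'"
    "odd_blocks (twist (cycle_of_list p')) = sym_diff (odd_blocks (twist f)) {w, y}"
proof -
  let ?X = "R @ X @ [a]" and ?Y = "Y @ [b]" and ?Z = "Z @ [c]" and ?W = "W @ [d]"
  have dist: "distinct (X @ [a] @ Y @ [b] @ Z @ [c] @ W @ [d] @ R)"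
    and A: "set (X @ [a] @ Y @ [b] @ Z @ [c] @ W @ [d] @ R) = A"
    using p by (auto simp: tour_def)
  have "f = cycle_of_list (?X @ ?Y @ ?Z @ ?W)"
    using cycle_of_list_append_commute[of "X @ [a] @ Y @ [b] @ Z @ [c] @ W @ [d]" R] dist
    unfolding f_def by simp
  moreover have "cycle_of_list p' = cycle_of_list (?X @ ?W @ ?Z @ ?Y)"
    using cycle_of_list_append_commute[of "X @ [a] @ W @ [d] @ Z @ [c] @ Y @ [b]" R] dist
    unfolding p'_def by auto
  moreover have "distinct (?X @ ?Y @ ?Z @ ?W)" using dist by auto
  ultimately have f': "cycle_of_list p' = f \<circ> transpose a c \<circ> transpose b d"
    using cycle_of_list_exchange4[of ?X ?Y ?Z ?W] by simp
  have abcd: "a \<in> A" "c \<in> A" "b \<in> A" "d \<in> A" "a \<noteq> c" "b \<noteq> d" using A dist by auto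
  have f: "f permutes A" "\<forall>a\<in>A. h (twist f a) = h a"
    using tour_permutes[OF p] tour_twist[OF p] by (auto simp: f_def)
  have hh: "h a = h c" "h b = h d" using h by auto
  note f1 = twist_transpose[OF f abcd(1,2) hh(1) abcd(5)]
  note f2 = twist_transpose[OF f1(1,2) abcd(3,4) hh(2) abcd(6)]
  have "distinct p'" "set p' = A" using dist A by (auto simp: p'_def)
  then show "tour p'"
    unfolding tour_iff f' using f2(2) by blast
  show "odd_blocks (twist (cycle_of_list p')) = sym_diff (odd_blocks (twist f)) {w, y}"
    unfolding f' f2(3) f1(3) h(1,2) using h(5) by blast
qed

lemma tour_interlaced:
  assumes p: "tour p" and sub: "subseq [w, y, w, y] (map h p)" and "w \<noteq> y"
  obtains p' where "tour p'"
    "odd_blocks (twist (cycle_of_list p')) = sym_diff (odd_blocks (twist (cycle_of_list p))) {w, y}"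
proof -
  obtain X a p1 where 1: "p = X @ a # p1" "h a = w" "subseq [y, w, y] (map h p1)"
    using sub by (rule subseq_map_ConsE)
  obtain Y b p2 where 2: "p1 = Y @ b # p2" "h b = y" "subseq [w, y] (map h p2)"
    using 1(3) by (rule subseq_map_ConsE)
  obtain Z c p3 where 3: "p2 = Z @ c # p3" "h c = w" "subseq [y] (map h p3)"
    using 2(3) by (rule subseq_map_ConsE)
  obtain W d R where 4: "p3 = W @ d # R" "h d = y"
    using 3(3) by (rule subseq_map_ConsE)
  have eq: "p = X @ [a] @ Y @ [b] @ Z @ [c] @ W @ [d] @ R" using 1 2 3 4 by simp
  show ?thesis
    using that tour_exchange4[OF p[unfolded eq] 1(2) 2(2) 3(2) 4(2) assms(3)] unfolding eq by blast
qed

text \<open>The predecessor of \<open>a\<close> on any tour ends at the tail of \<open>a\<close>. So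
  every arc shows up as two cyclically consecutive letters in the word of heads, whichever tour is
  read.\<close>

lemma tour_cyc_adjacent:
  assumes p: "tour p" and a: "a \<in> A"
  shows "cyc_adjacent (map h p) (h (inv t a)) (h a)"
proof -
  have d: "distinct p" "set p = A" using p by (auto simp: tour_def)
  have adj: "cyc_adjacent (map h p) (h b) (h (cycle_of_list p b))" if b: "b \<in> A" for b
  proof -
    have ne: "p \<noteq> []" using b d by auto
    show ?thesis
    proof (cases "b = last p")
      case True
      then have "h (cycle_of_list p b) = hd (map h p)"
        using cycle_of_list_last[OF d(1) ne] ne by (simp add: hd_map)
      moreover have "map h p = map h (butlast p) @ [h b]"
        using True ne by (metis append_butlast_last_id list.simps(8,9) map_append)
      ultimately show ?thesis
        unfolding cyc_adjacent_def sublist_pair_append using ne True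
        by (simp add: last_map)
    next
      case False
      then obtain X c Y where "p = X @ b # c # Y" using split_at_not_last b d by metis
      moreover from this have "cycle_of_list p b = c" using cycle_of_list_next d by metis
      ultimately show ?thesis
        unfolding cyc_adjacent_def sublist_pair_append by (simp add: sublist_pair_append sublist_def) blast
    qed
  qed
  let ?f = "cycle_of_list p"
  have f: "?f permutes A" using tour_permutes[OF p] .
  define b where "b = inv ?f a"
  have b: "b \<in> A" "?f b = a"
    using a f permutes_in_image[OF permutes_inv[OF f]] permutes_inverses[OF f] by (auto simp: b_def)
  then show ?thesis using adj[OF b(1)] p unfolding tour_def by metis
qed

end

text \<open>The arc \<open>a\<close> has head \<open>h a\<close> and tail \<open>h (inv t a)\<close>, the head of its predecessor on the circuit.\<close>

locale dense_circuit = circuit +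
  fixes q :: nat
  assumes q: "5 * q + 7 \<le> card (h ` A)"
    and dense: "v \<in> h ` A \<Longrightarrow>
      card {x \<in> h ` A. x \<noteq> v \<and> \<not> (\<exists>a\<in>A. {h (inv t a), h a} = {v, x})} \<le> q"
begin

text \<open>The result on words is applied to the word of heads along the tour. An exchange of
  letters lifts to an exchange of arcs, which leaves the parities as they are.\<close>

lemma tour_reduce:
  assumes p: "tour p" and wy: "w \<in> odd_blocks (twist (cycle_of_list p))"
      "y \<in> odd_blocks (twist (cycle_of_list p))" "w \<noteq> y"
  obtains p' where "tour p'"
    "odd_blocks (twist (cycle_of_list p')) = odd_blocks (twist (cycle_of_list p)) - {w, y}"
proof -
  have sym: "sym_diff (odd_blocks (twist (cycle_of_list p))) {w, y} = odd_blocks (twist (cycle_of_list p)) - {w, y}"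
    using wy by auto
  have V: "w \<in> h ` A" "y \<in> h ` A" using wy by (auto simp: odd_blocks_def)
  have set: "set (map h p) = h ` A" using p by (simp add: tour_def)
  \<comment> \<open>Adjacent vertices are adjacent in the word of every tour, so the bound on
    non-neighbours holds for each word.\<close>
  have deg: "card {x \<in> h ` A. x \<noteq> v \<and> \<not> cyc_adjacent (map h p) v x} \<le> q" if "v \<in> h ` A" for v
  proof -
    have "cyc_adjacent (map h p) v x" if "a \<in> A" "{h (inv t a), h a} = {v, x}" for a x
      using tour_cyc_adjacent[OF p that(1)] that(2) cyc_adjacent_sym by (metis doubleton_eq_iff)
    then have "{x \<in> h ` A. x \<noteq> v \<and> \<not> cyc_adjacent (map h p) v x}
        \<subseteq> {x \<in> h ` A. x \<noteq> v \<and> \<not> (\<exists>a\<in>A. {h (inv t a), h a} = {v, x})}" by blast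
    then have "card {x \<in> h ` A. x \<noteq> v \<and> \<not> cyc_adjacent (map h p) v x}
        \<le> card {x \<in> h ` A. x \<noteq> v \<and> \<not> (\<exists>a\<in>A. {h (inv t a), h a} = {v, x})}"
      by (intro card_mono) auto
    then show ?thesis using dense[OF that] by linarith
  qed
  from interlaced_after_exchange[OF set V wy(3) q deg]
  consider k where "subseq [w, y, w, y] (rotate k (map h p))"
    | k B C D E s where "rotate k (map h p) = B @ [s] @ C @ [s] @ D @ [s] @ E"
        "subseq [w, y, w, y] (B @ [s] @ D @ [s] @ C @ [s] @ E)" by blast
  then show ?thesis
  proof cases
    case 1
    then have "subseq [w, y, w, y] (map h (rotate k p))" by (simp add: rotate_map)
    from tour_interlaced[OF tour_rotate(1)[OF p] this wy(3)] show ?thesis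
      using that tour_rotate(2)[OF p] sym by metis
  next
    case dec: 2
    note sub = dec(2)
    from dec(1) have "map h (rotate k p) = B @ s # C @ s # D @ s # E" by (simp add: rotate_map)
    then obtain B' a r1 where 1: "rotate k p = B' @ a # r1" "map h B' = B" "h a = s"
      "map h r1 = C @ s # D @ s # E" by (rule map_eq_append_ConsE)
    obtain C' b r2 where 2: "r1 = C' @ b # r2" "map h C' = C" "h b = s" "map h r2 = D @ s # E"
      using 1(4) by (rule map_eq_append_ConsE)
    obtain D' c E' where 3: "r2 = D' @ c # E'" "map h D' = D" "h c = s" "map h E' = E"
      using 2(4) by (rule map_eq_append_ConsE)
    have r: "rotate k p = B' @ [a] @ C' @ [b] @ D' @ [c] @ E'" using 1 2 3 by simp
    note s = 1(3) 2(3) 3(3) and B = 1(2) 2(2) 3(2,4)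
    have rp: "tour (B' @ [a] @ C' @ [b] @ D' @ [c] @ E')"
      "cycle_of_list (B' @ [a] @ C' @ [b] @ D' @ [c] @ E') = cycle_of_list p"
      using tour_rotate[OF p, of k] r by simp_all
    note ex = tour_exchange3[OF rp(1) s]
    have "subseq [w, y, w, y] (map h (B' @ [a] @ D' @ [c] @ C' @ [b] @ E'))"
      using sub B s by simp
    from tour_interlaced[OF ex(1) this wy(3)] show ?thesis
      using that ex(3) rp(2) sym by metis
  qed
qed

text \<open>In a tour with the fewest odd vertices, two of them would be removed together by
  \<open>tour_reduce\<close>. The given circuit shows that tours exist.\<close>

lemma tour_at_most_one_odd:
  obtains p where "tour p" "card (odd_blocks (twist (cycle_of_list p))) \<le> 1"
proof -
  have "inv t \<circ> t = id" using permutes_inv_o(2)[OF cycle_permutes] .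
  then have "tour t_arcs" using distinct_t by (simp add: tour_def fun_eq_iff)
  then obtain p where p: "tour p" and min: "\<And>p'. tour p' \<Longrightarrow>
      card (odd_blocks (twist (cycle_of_list p))) \<le> card (odd_blocks (twist (cycle_of_list p')))"
    using ex_has_least_nat[of tour t_arcs "\<lambda>p. card (odd_blocks (twist (cycle_of_list p)))"] by blast
  have "card (odd_blocks (twist (cycle_of_list p))) \<le> 1"
  proof (rule ccontr)
    let ?O = "odd_blocks (twist (cycle_of_list p))"
    assume "\<not> card ?O \<le> 1"
    then obtain w y where wy: "w \<in> ?O" "y \<in> ?O" "w \<noteq> y"
      using card_le_Suc0_iff_eq[OF finite_odd_blocks] by (metis One_nat_def)
    obtain p' where p': "tour p'" "odd_blocks (twist (cycle_of_list p')) = ?O - {w, y}"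
      using tour_reduce[OF p wy] .
    have "card (?O - {w, y}) < card ?O"
      using wy by (intro psubset_card_mono finite_odd_blocks) auto
    then show False using min[OF p'(1)] p'(2) by simp
  qed
  then show ?thesis using that p by blast
qed

text \<open>Among the tours with at most one odd block, one with the fewest orbits has at most two
  orbits at each vertex. Two orbits occur only at an odd vertex; the transposition that merges them
  splits the tour into \<open>p1\<close> and \<open>p2\<close>. If there is no such vertex,
  \<open>p2\<close> is empty.\<close>

lemma cyclic_blocks:
  obtains p1 p2 where "distinct (p1 @ p2)" "set (p1 @ p2) = A" "p1 \<noteq> []"
    "\<forall>a\<in>A. h (twist (cycle_of_list p1 \<circ> cycle_of_list p2) a) = h a"
    "\<forall>v\<in>h ` A. cyclic_on (twist (cycle_of_list p1 \<circ> cycle_of_list p2)) (block v)"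
proof -
  define good where "good p \<longleftrightarrow> tour p \<and> card (odd_blocks (twist (cycle_of_list p))) \<le> 1" for p
  define orbs where "orbs p = card (orbit (twist (cycle_of_list p)) ` A)" for p
  obtain p0 where "good p0" using tour_at_most_one_odd unfolding good_def by blast
  then obtain p where p: "good p" and min: "\<And>p'. good p' \<Longrightarrow> orbs p \<le> orbs p'"
    using ex_has_least_nat[of good p0 orbs] by blast
  let ?f = "cycle_of_list p"
  let ?c = "twist ?f"
  have tour: "tour p" and odd: "card (odd_blocks ?c) \<le> 1" using p by (auto simp: good_def)
  note c = tour_twist[OF tour]
  have perm: "permutation ?c" using c by (auto simp: permutation_permutes)
  note self = permutation_self_in_orbit[OF perm]
  have dp: "distinct p" "set p = A" using tour by (auto simp: tour_def)
  have orbit_block: "orbit ?c x \<subseteq> block v" if "x \<in> block v" for x v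
  proof
    fix z assume "z \<in> orbit ?c x"
    then show "z \<in> block v"
      by induction (use that c permutes_in_image[OF c(1)] in \<open>auto simp: block_def\<close>)
  qed
  \<comment> \<open>Three orbits at one vertex are merged by a 3-cycle, which keeps the tour good.\<close>
  have no3: False if S: "S \<subseteq> block v" "card S = 3" and inj: "inj_on (orbit ?c) S" for S v
  proof -
    have "S \<subseteq> set p" "S \<noteq> {}" using S dp by (auto simp: block_def)
    then obtain X a p1 where 1: "p = X @ a # p1" "a \<in> S" "S - {a} \<subseteq> set p1"
      by (rule split_list_first_of_set)
    have c1: "card (S - {a}) = 2" using 1 S by simp
    then have "S - {a} \<noteq> {}" by (metis card.empty zero_neq_numeral)
    with 1(3) obtain Y b p2 where 2: "p1 = Y @ b # p2" "b \<in> S - {a}" "S - {a} - {b} \<subseteq> set p2"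
      by (rule split_list_first_of_set)
    have "card (S - {a} - {b}) = 1" using 2 c1 by simp
    then have "S - {a} - {b} \<noteq> {}" by (metis card.empty zero_neq_one)
    with 2(3) obtain Z d p3 where 3: "p2 = Z @ d # p3" "d \<in> S - {a} - {b}"
      by (rule split_list_first_of_set)
    have eq: "p = X @ [a] @ Y @ [b] @ Z @ [d] @ p3" using 1 2 3 by simp
    have hs: "h a = v" "h b = v" "h d = v" using 1 2 3 S by (auto simp: block_def)
    have inA: "a \<in> A" "b \<in> A" "d \<in> A" using 1 2 3 S by (auto simp: block_def)
    define p' where "p' = X @ [a] @ Z @ [d] @ Y @ [b] @ p3"
    note ex = tour_exchange3[OF tour[unfolded eq] hs, folded eq p'_def]
    have "good p'" using ex odd by (simp add: good_def)
    have ne: "orbit ?c b \<noteq> orbit ?c d" "orbit ?c a \<noteq> orbit ?c d" "orbit ?c a \<noteq> orbit ?c b"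
      using inj 1 2 3 by (auto simp: inj_on_def)
    have notin: "x \<notin> orbit ?c z" if "orbit ?c z \<noteq> orbit ?c x" for x z
      using that cyclic_on_orbit'[OF perm, of z] orbit_cyclic_eq3 by metis
    \<comment> \<open>The first transposition merges the orbits of \<open>b\<close> and
      \<open>d\<close> and leaves that of \<open>a\<close> alone, so the second one merges
      again.\<close>
    let ?c1 = "?c \<circ> transpose b d"
    have perm1: "permutation ?c1" using perm by (simp add: permutation_compose permutation_swap_id)
    have "a \<notin> orbit ?c b \<union> orbit ?c d" using notin ne by blast
    then have "orbit ?c1 a = orbit ?c a"
      using orbit_transpose_merge(3)[OF perm] notin ne by metis
    then have "d \<notin> orbit ?c1 a" using notin ne by metis
    from card_orbits_transpose_less[OF perm1 _ inA(1,3) this]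
    have "card (orbit (?c1 \<circ> transpose a d) ` A) < card (orbit ?c1 ` A)" by simp
    also have "\<dots> < card (orbit ?c ` A)"
      using card_orbits_transpose_less[OF perm _ inA(2,3)] notin ne by simp
    finally have "orbs p' < orbs p"
      unfolding orbs_def ex(2) twist_comp .
    then show False using min[OF \<open>good p'\<close>] by simp
  qed
  have dich: "cyclic_on ?c (block v) \<or> (v \<in> odd_blocks ?c \<and>
      (\<exists>x y. x \<in> block v \<and> y \<in> block v \<and> x \<noteq> y \<and> cyclic_on (?c \<circ> transpose x y) (block v)))"
    if v: "v \<in> h ` A" for v
  proof (cases "cyclic_on ?c (block v)")
    case False
    obtain x where x: "x \<in> block v" using v by (auto simp: block_def)
    then have "orbit ?c x \<noteq> block v" using False unfolding cyclic_on_def by blast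
    then obtain y where y: "y \<in> block v" "y \<notin> orbit ?c x" using orbit_block[OF x] by auto
    have xny: "x \<notin> orbit ?c y" using orbit_disjoint[OF perm y(2)] .
    have "block v \<subseteq> orbit ?c x \<union> orbit ?c y"
    proof
      fix z assume z: "z \<in> block v"
      show "z \<in> orbit ?c x \<union> orbit ?c y"
      proof (rule ccontr)
        assume "z \<notin> orbit ?c x \<union> orbit ?c y"
        then have "orbit ?c x \<noteq> orbit ?c y" "orbit ?c x \<noteq> orbit ?c z" "orbit ?c y \<noteq> orbit ?c z"
          using y xny self by blast+
        then have "inj_on (orbit ?c) {x, y, z}" "x \<noteq> y" "x \<noteq> z" "y \<noteq> z" by (auto simp: inj_on_def)
        then show False using no3[of "{x, y, z}" v] x y z by simp
      qed
    qed
    then have "orbit (?c \<circ> transpose x y) x = block v"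
      using orbit_transpose_merge(1)[OF perm y(2)] orbit_block[OF x] orbit_block[OF y(1)] by auto
    then have cyc: "cyclic_on (?c \<circ> transpose x y) (block v)"
      using x unfolding cyclic_on_def by blast
    have xy: "x \<in> A" "y \<in> A" "h x = h y" "x \<noteq> y" "h x = v"
      using x y self by (auto simp: block_def)
    have "?c \<circ> transpose x y permutes A" using c xy by (intro permutes_compose permutes_swap_id)
    \<comment> \<open>A single cycle has the right sign. As the transposition changed the sign at
      \<open>v\<close>, it was wrong before.\<close>
    then have "v \<notin> odd_blocks (?c \<circ> transpose x y)"
      using sign_perm_restrict_cyclic cyc by (auto simp: odd_blocks_def)
    then have "v \<in> odd_blocks ?c"
      using odd_blocks_transpose[OF c xy(1-4)] xy(5) by auto
    then show ?thesis using cyc x y xy by blast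
  qed simp
  show ?thesis
  proof (cases "\<forall>v\<in>h ` A. cyclic_on ?c (block v)")
    case True
    have "p \<noteq> []" using q dp by auto
    then show ?thesis using that[of p "[]"] True dp c by (auto simp: twist_def)
  next
    case False
    then obtain v x y where v: "v \<in> odd_blocks ?c" and xy: "x \<in> block v" "y \<in> block v" "x \<noteq> y"
      and cyc: "cyclic_on (?c \<circ> transpose x y) (block v)" using dich by blast
    have "{x, y} \<subseteq> set p" "{x, y} \<noteq> {}" using xy dp by (auto simp: block_def)
    then obtain X a p1 where 1: "p = X @ a # p1" "a \<in> {x, y}" "{x, y} - {a} \<subseteq> set p1"
      by (rule split_list_first_of_set)
    have "{x, y} - {a} \<noteq> {}" using xy 1 by auto
    with 1(3) obtain Y b p2 where 2: "p1 = Y @ b # p2" "b \<in> {x, y} - {a}"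
      by (rule split_list_first_of_set)
    have ab: "transpose x y = transpose a b" using 1(2) 2(2) by (auto simp: transpose_commute)
    have eq: "p = (X @ [a] @ Y @ [b]) @ p2" using 1 2 by simp
    \<comment> \<open>Reading the tour from behind \<open>b\<close> puts \<open>a\<close> and
      \<open>b\<close> at the ends of the two parts, where the transposition cuts the cycle.\<close>
    let ?p1 = "p2 @ X @ [a]" and ?p2 = "Y @ [b]"
    have d: "distinct (?p1 @ ?p2)" and A: "set (?p1 @ ?p2) = A" using dp eq by auto
    have "?f = cycle_of_list (?p1 @ ?p2)"
      using cycle_of_list_append_commute[of "X @ [a] @ Y @ [b]" p2] dp eq by simp
    then have f: "cycle_of_list ?p1 \<circ> cycle_of_list ?p2 = ?f \<circ> transpose x y"
      using cycle_of_list_split[OF d] unfolding ab by simp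
    have xy': "x \<in> A" "y \<in> A" "h x = h y" using xy by (auto simp: block_def)
    have "odd_blocks ?c = {v}"
      using odd v finite_odd_blocks card_le_Suc0_iff_eq[OF finite_odd_blocks, of ?c] by auto
    then have "cyclic_on ?c (block u)" if "u \<in> h ` A" "u \<noteq> v" for u using dich that by blast
    then have "cyclic_on (?c \<circ> transpose x y) (block u)" if "u \<in> h ` A" for u
    proof (cases "u = v")
      case False
      have "(?c \<circ> transpose x y) a = ?c a" if "a \<in> block u" for a
      proof -
        have "a \<noteq> x" "a \<noteq> y" using that xy False by (auto simp: block_def)
        then show ?thesis by simp
      qed
      then show ?thesis using cyclic_cong \<open>\<And>u. u \<in> h ` A \<Longrightarrow> u \<noteq> v \<Longrightarrow> cyclic_on ?c (block u)\<close> that False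
        by metis
    qed (use cyc in simp)
    moreover have "\<forall>a\<in>A. h (twist (?f \<circ> transpose x y) a) = h a"
      using twist_transpose(2)[OF tour_permutes[OF tour] c(2) xy' xy(3)] .
    ultimately show ?thesis using that[of ?p1 ?p2] d A unfolding f twist_comp by simp
  qed
qed

end

section \<open>Embeddings\<close>

lemma cyclic_walk_rotate: "cyclic_walk (rotate i p) = cyclic_walk p"
proof -
  have "\<exists>k'. rotate k p = rotate k' (rotate i p)" for k
  proof (cases "p = []")
    case False
    \<comment> \<open>Another \<open>i * (length p - 1)\<close> rotations complete the first
      \<open>i\<close> to full turns.\<close>
    have "k + i * (length p - 1) + i = k + i * length p"
      using False by (cases "length p") auto
    then have "rotate (k + i * (length p - 1)) (rotate i p) = rotate ((k + i * length p) mod length p) p"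
      by (simp only: rotate_rotate rotate_conv_mod[symmetric])
    also have "\<dots> = rotate k p" by (simp add: rotate_conv_mod[symmetric])
    finally show ?thesis by metis
  qed simp
  then show ?thesis
    unfolding cyclic_walk_def by (auto simp: rotate_rotate)
qed

lemma set_cyclic_walk: "q \<in> cyclic_walk p \<Longrightarrow> set q = set p"
  by (auto simp: cyclic_walk_def)

lemma self_in_cyclic_walk: "p \<in> cyclic_walk p"
  unfolding cyclic_walk_def using rotate0 by (metis (mono_tags, lifting) id_apply mem_Collect_eq)

lemma cyclic_walk_eq_imp_set_eq: "cyclic_walk p = cyclic_walk q \<Longrightarrow> set p = set q"
  using set_cyclic_walk self_in_cyclic_walk by metis

text \<open>The case \<open>p = []\<close> gives no walk; it covers an absent second
  antiface.\<close>

lemma cyclic_walks_of_cycle: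
  assumes "distinct p" and f: "\<And>a. a \<in> set p \<Longrightarrow> f a = cycle_of_list p a"
  shows "(\<lambda>a. cyclic_walk (support f a)) ` set p = (if p = [] then {} else {cyclic_walk p})"
proof -
  have "cyclic_walk (support f a) = cyclic_walk p" if "a \<in> set p" for a
  proof -
    obtain i where i: "i < length p" "a = p ! i" using \<open>a \<in> set p\<close> by (metis in_set_conv_nth)
    have "support f (p ! i) = rotate i p"
      using f cycle_of_list_nth[OF assms(1)] by (intro support_along_list[OF assms(1) _ i(1)]) simp
    then show ?thesis using i cyclic_walk_rotate by metis
  qed
  then have "(\<lambda>a. cyclic_walk (support f a)) ` set p = (\<lambda>a. cyclic_walk p) ` set p"
    by (intro image_cong) auto
  then show ?thesis by (simp add: image_constant_conv)
qed

lemma cyclic_walks_of_two_cycles: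
  assumes d: "distinct (p @ q)"
  shows "(\<lambda>a. cyclic_walk (support (cycle_of_list p \<circ> cycle_of_list q) a)) ` set (p @ q) =
    (if p = [] then {} else {cyclic_walk p}) \<union> (if q = [] then {} else {cyclic_walk q})"
proof -
  have dd: "distinct p" "distinct q" "set p \<inter> set q = {}" using d by auto
  have "(cycle_of_list p \<circ> cycle_of_list q) a = cycle_of_list p a" if "a \<in> set p" for a
  proof -
    have "a \<notin> set q" using that dd(3) by blast
    then show ?thesis by (simp add: id_outside_supp)
  qed
  moreover have "(cycle_of_list p \<circ> cycle_of_list q) a = cycle_of_list q a" if "a \<in> set q" for a
  proof -
    have "cycle_of_list q a \<in> set q" using that permutes_in_image[OF cycle_permutes[of q]] by simp
    then have "cycle_of_list q a \<notin> set p" using dd(3) by blast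
    then show ?thesis by (simp add: id_outside_supp)
  qed
  ultimately show ?thesis
    using cyclic_walks_of_cycle[OF dd(1)] cyclic_walks_of_cycle[OF dd(2)]
    by (simp add: image_Un)
qed

text \<open>Equal cyclic walks have equal sets of entries, so a single walk passes through all of
  \<open>A\<close> and \<open>f\<close> is one cycle.\<close>

lemma sign_single_walk:
  assumes f: "f permutes A" and A: "finite A" "A \<noteq> {}"
    and W: "card ((\<lambda>a. cyclic_walk (support f a)) ` A) = 1"
  shows "sign f = (- 1) ^ (card A - 1)"
proof -
  obtain x where x: "x \<in> A" using A by auto
  have perm: "permutation f" using f A by (auto simp: permutation_permutes)
  have "A \<subseteq> set (support f x)"
  proof
    fix a assume a: "a \<in> A"
    obtain w where "(\<lambda>a. cyclic_walk (support f a)) ` A = {w}" using W card_1_singletonE by blast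
    then have "cyclic_walk (support f a) = cyclic_walk (support f x)" using a x by blast
    then have "set (support f a) = set (support f x)" by (rule cyclic_walk_eq_imp_set_eq)
    moreover have "(f ^^ 0) a \<in> set (support f a)" unfolding support_set[OF perm] by (rule rangeI)
    ultimately show "a \<in> set (support f x)" by simp
  qed
  then show ?thesis using sign_cyclic[OF f A(1) _ x] by blast
qed

text \<open>Each block contributes its size minus one to the exponent, and these numbers add up to
  the size of \<open>A\<close> minus the number of blocks.\<close>

lemma sign_cyclic_blocks:
  assumes c: "c permutes A" and fin: "finite A"
    and cyc: "\<And>v. v \<in> h ` A \<Longrightarrow> cyclic_on c {a \<in> A. h a = v}"
  shows "sign c = (if even (card (h ` A) + card A) then 1 else - 1)"
proof -
  let ?B = "\<lambda>v. {a \<in> A. h a = v}"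
  have "h (c a) = h a" if "a \<in> A" for a
    using cyclic_on_inI[OF cyc[of "h a"], of a] that by auto
  then have "sign c = (\<Prod>v\<in>h ` A. sign (perm_restrict c (?B v)))"
    using c fin by (intro sign_eq_prod_blocks) auto
  also have "\<dots> = (\<Prod>v\<in>h ` A. (- 1) ^ (card (?B v) - 1))"
    using sign_perm_restrict_cyclic[OF c cyc] by (intro prod.cong) auto
  also have "\<dots> = (- 1) ^ (\<Sum>v\<in>h ` A. card (?B v) - 1)" by (simp add: power_sum)
  finally have sign: "sign c = (- 1) ^ (\<Sum>v\<in>h ` A. card (?B v) - 1)" .
  \<comment> \<open>Blocks over values of \<open>h\<close> are nonempty, so the truncated
    subtraction is exact.\<close>
  have pos: "card (?B v) \<ge> 1" if "v \<in> h ` A" for v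
    using that fin by (auto simp: Suc_le_eq card_gt_0_iff)
  have "card A = (\<Sum>v\<in>h ` A. card (?B v))"
    using sum.image_gen[OF fin, of "\<lambda>_. 1 :: nat" h] by simp
  also have "\<dots> = (\<Sum>v\<in>h ` A. (card (?B v) - 1) + 1)"
    by (intro sum.cong refl) (metis le_add_diff_inverse2 pos)
  also have "\<dots> = (\<Sum>v\<in>h ` A. card (?B v) - 1) + card (h ` A)" by (simp only: sum.distrib) simp
  finally have "card A = (\<Sum>v\<in>h ` A. card (?B v) - 1) + card (h ` A)" .
  then have "even (\<Sum>v\<in>h ` A. card (?B v) - 1) \<longleftrightarrow> even (card (h ` A) + card A)"
    by presburger
  then show ?thesis unfolding sign by (simp add: uminus_power_if)
qed

section \<open>Embeddings and their face steps\<close>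

lemma permutes_of_inj_into:
  assumes "finite A" "\<And>a. a \<in> A \<Longrightarrow> f a \<in> A" "inj_on f A" "\<And>a. a \<notin> A \<Longrightarrow> f a = a"
  shows "f permutes A"
proof (rule bij_imp_permutes)
  have "f ` A = A" using assms by (intro endo_inj_surj) auto
  then show "bij_betw f A A" using assms(3) by (simp add: bij_betw_def)
qed (use assms(4) in auto)

text \<open>As the half-arcs alternate, \<open>\<rho>\<close> leads from \<open>Entering a\<close>
  to \<open>Leaving (antiface_step \<rho> a)\<close>, and from \<open>Leaving x\<close> to the
  entering half-arc of the arc that \<open>proface_step \<rho>\<close> sends to \<open>x\<close>.
  Two steps of the rotation are therefore
  \<open>inv (proface_step \<rho>) \<circ> antiface_step \<rho>\<close> on entering arcs.\<close>

lemma (in fin_digraph) embedding_steps: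
  assumes emb: "oriented_directed_embedding G \<rho>"
  shows "antiface_step \<rho> permutes arcs G" "proface_step \<rho> permutes arcs G"
    "v \<in> head G ` arcs G \<Longrightarrow>
      cyclic_on (inv (proface_step \<rho>) \<circ> antiface_step \<rho>) {a \<in> arcs G. head G a = v}"
proof -
  let ?s = "antiface_step \<rho>" and ?t = "proface_step \<rho>"
  let ?c = "inv ?t \<circ> ?s"
  have perm: "\<rho> permutes half_arcs G"
    and alt: "\<And>h. h \<in> half_arcs G \<Longrightarrow> is_Entering (\<rho> h) \<longleftrightarrow> \<not> is_Entering h"
    and cyc: "\<And>v. v \<in> verts G \<Longrightarrow> half_arcs_at G v \<noteq> {} \<Longrightarrow> cyclic_on \<rho> (half_arcs_at G v)"
    using emb by (auto simp: oriented_directed_embedding_def)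
  note iperm = permutes_inv[OF perm]
  have H: "Entering a \<in> half_arcs G \<longleftrightarrow> a \<in> arcs G" "Leaving a \<in> half_arcs G \<longleftrightarrow> a \<in> arcs G" for a
    by (auto simp: half_arcs_def)
  have s: "\<rho> (Entering a) = Leaving (?s a)" if "a \<in> arcs G" for a
    using alt[of "Entering a"] that H unfolding antiface_step_def
    by (cases "\<rho> (Entering a)") auto
  have s_in: "?s a \<in> arcs G" if "a \<in> arcs G" for a
    using s[OF that] permutes_in_image[OF perm, of "Entering a"] H that by simp
  have t: "inv \<rho> (Entering a) = Leaving (?t a)" if "a \<in> arcs G" for a
  proof -
    have "inv \<rho> (Entering a) \<in> half_arcs G" using permutes_in_image[OF iperm] H that by simp
    from alt[OF this] have "\<not> is_Entering (inv \<rho> (Entering a))"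
      using permutes_inverses(1)[OF perm] by simp
    then show ?thesis unfolding proface_step_def by (cases "inv \<rho> (Entering a)") auto
  qed
  have t_in: "?t a \<in> arcs G" if "a \<in> arcs G" for a
    using t[OF that] permutes_in_image[OF iperm, of "Entering a"] H that by simp
  have inj: "inj \<rho>" "inj (inv \<rho>)" using perm iperm permutes_inj by blast+
  show sp: "?s permutes arcs G"
  proof (rule permutes_of_inj_into)
    show "inj_on ?s (arcs G)" using s inj(1) by (intro inj_onI) (metis half_arc.inject(1) injD)
    show "?s a = a" if "a \<notin> arcs G" for a
      using permutes_not_in[OF perm, of "Entering a"] H that by (simp add: antiface_step_def)
  qed (use s_in in auto)
  show tp: "?t permutes arcs G"
  proof (rule permutes_of_inj_into)
    show "inj_on ?t (arcs G)" using t inj(2) by (intro inj_onI) (metis half_arc.inject(1) injD)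
    show "?t a = a" if "a \<notin> arcs G" for a
      using permutes_not_in[OF iperm, of "Entering a"] H that by (simp add: proface_step_def)
  qed (use t_in in auto)
  have leave: "\<rho> (Leaving x) = Entering (inv ?t x)" if "x \<in> arcs G" for x
  proof -
    have "inv ?t x \<in> arcs G" using permutes_in_image[OF permutes_inv[OF tp]] that by simp
    from t[OF this] have "inv \<rho> (Entering (inv ?t x)) = Leaving x"
      using permutes_inverses(1)[OF tp] by simp
    then show ?thesis using permutes_inverses(1)[OF perm] by metis
  qed
  show "cyclic_on ?c {a \<in> arcs G. head G a = v}" if v: "v \<in> head G ` arcs G"
  proof -
    let ?X = "{a \<in> arcs G. head G a = v}"
    obtain a where a: "a \<in> arcs G" "head G a = v" using v by auto
    have Ea: "Entering a \<in> half_arcs_at G v" using a H by (simp add: half_arcs_at_def)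
    have cycv: "cyclic_on \<rho> (half_arcs_at G v)" using cyc[of v] Ea a head_in_verts by blast
    have orb: "orbit \<rho> (Entering a) = half_arcs_at G v" using orbit_cyclic_eq3[OF cycv Ea] .
    \<comment> \<open>To carry the induction through leaving half-arcs, each is represented by the
      entering half-arc that follows it.\<close>
    have walk: "case k of Entering b \<Rightarrow> b \<in> orbit ?c a | Leaving x \<Rightarrow> inv ?t x \<in> orbit ?c a"
      if "k \<in> orbit \<rho> (Entering a)" for k
      using that
    proof (induction rule: orbit.induct)
      case base
      have "?c a \<in> orbit ?c a" by (rule orbit.base)
      then show ?case using s[OF a(1)] by simp
    next
      case (step k)
      have k: "arc_of k \<in> arcs G" using step.hyps orb by (auto simp: half_arcs_at_def half_arcs_def)
      show ?case
      proof (cases k)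
        case (Entering b)
        then have "b \<in> orbit ?c a" using step.IH by simp
        then have "?c b \<in> orbit ?c a" by (rule orbit.step)
        then show ?thesis using s k Entering by simp
      next
        case (Leaving x)
        then show ?thesis using leave k step.IH by simp
      qed
    qed
    have "?X \<subseteq> orbit ?c a"
    proof
      fix b assume "b \<in> ?X"
      then have "Entering b \<in> orbit \<rho> (Entering a)" using orb H by (simp add: half_arcs_at_def)
      from walk[OF this] show "b \<in> orbit ?c a" by simp
    qed
    moreover have "orbit ?c a \<subseteq> ?X"
    proof
      have step: "?c b \<in> ?X" if "b \<in> ?X" for b
      proof -
        have b: "b \<in> arcs G" "Entering b \<in> half_arcs_at G v"
          using that H by (auto simp: half_arcs_at_def)
        have "\<rho> (\<rho> (Entering b)) = Entering (?c b)" using s leave s_in b by simp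
        then have "Entering (?c b) \<in> half_arcs_at G v"
          using b cyclic_on_inI[OF cycv] by metis
        then show ?thesis using H by (simp add: half_arcs_at_def)
      qed
      fix b assume "b \<in> orbit ?c a"
      then show "b \<in> ?X"
      proof induction
        case base
        show ?case using step a by blast
      next
        case (step b)
        then show ?case using \<open>\<And>b. b \<in> ?X \<Longrightarrow> ?c b \<in> ?X\<close> by blast
      qed
    qed
    ultimately show ?thesis using a unfolding cyclic_on_def by blast
  qed
qed

text \<open>The rotation recovered from an antiface step \<open>s\<close> and a proface step
  \<open>t\<close>, extended by the identity as \<open>permutes\<close> demands.\<close>

definition rotation_of_steps ::
    "'b set \<Rightarrow> ('b \<Rightarrow> 'b) \<Rightarrow> ('b \<Rightarrow> 'b) \<Rightarrow> 'b half_arc \<Rightarrow> 'b half_arc" where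
  "rotation_of_steps A s t k = (if arc_of k \<notin> A then k else
     case k of Entering a \<Rightarrow> Leaving (s a) | Leaving a \<Rightarrow> Entering (inv t a))"

text \<open>Exchanging \<open>s\<close> and \<open>t\<close> reverses the rotation, as in the mirror
  image.\<close>

lemma rotation_of_steps_bij:
  fixes s t :: "'b \<Rightarrow> 'b"
  assumes "s permutes A" "t permutes A"
  shows "bij (rotation_of_steps A s t)" "inv (rotation_of_steps A s t) = rotation_of_steps A t s"
proof -
  have comp: "rotation_of_steps A t s \<circ> rotation_of_steps A s t = id"
    if "s permutes A" "t permutes A" for s t :: "'b \<Rightarrow> 'b"
  proof
    fix k
    have "a \<in> A \<Longrightarrow> s a \<in> A" "a \<in> A \<Longrightarrow> inv t a \<in> A" for a
      using permutes_in_image[OF that(1)] permutes_in_image[OF permutes_inv[OF that(2)]] by blast+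
    then show "(rotation_of_steps A t s \<circ> rotation_of_steps A s t) k = id k"
      using permutes_inverses[OF that(1)] permutes_inverses[OF that(2)]
      by (cases k) (auto simp: rotation_of_steps_def)
  qed
  note c = comp[OF assms] comp[OF assms(2,1)]
  show "bij (rotation_of_steps A s t)" using o_bij[OF c] .
  show "inv (rotation_of_steps A s t) = rotation_of_steps A t s"
    using inv_unique_comp[OF c(2,1)] .
qed

text \<open>Converse to \<open>embedding_steps\<close>. By the condition on \<open>tail\<close>, an
  arc \<open>x\<close> leaves the vertex that \<open>inv t x\<close> enters, so the rotation stays
  at one vertex.\<close>

lemma (in fin_digraph) embedding_of_steps:
  assumes s: "s permutes arcs G" and t: "t permutes arcs G"
    and tail: "\<forall>a\<in>arcs G. tail G (t a) = head G a"
    and cyc: "\<forall>v\<in>head G ` arcs G. cyclic_on (inv t \<circ> s) {a \<in> arcs G. head G a = v}"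
  defines "\<rho> \<equiv> rotation_of_steps (arcs G) s t"
  shows "oriented_directed_embedding G \<rho>" "antiface_step \<rho> = s" "proface_step \<rho> = t"
proof -
  note bij = rotation_of_steps_bij[OF s t]
  note in_arcs = permutes_in_image[OF s] permutes_in_image[OF t]
    permutes_in_image[OF permutes_inv[OF s]] permutes_in_image[OF permutes_inv[OF t]]
  show "antiface_step \<rho> = s"
    using permutes_not_in[OF s] by (auto simp: antiface_step_def \<rho>_def rotation_of_steps_def)
  show "proface_step \<rho> = t"
    unfolding proface_step_def \<rho>_def bij(2)
    using permutes_not_in[OF t] by (auto simp: rotation_of_steps_def)
  have \<rho>: "\<rho> (Entering a) = Leaving (s a)" "\<rho> (Leaving a) = Entering (inv t a)" if "a \<in> arcs G" for a
    using that by (auto simp: \<rho>_def rotation_of_steps_def)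
  have tail': "head G (inv t x) = tail G x" if "x \<in> arcs G" for x
    using tail[rule_format, of "inv t x"] permutes_inverses(1)[OF t] in_arcs(4) that by simp
  have perm: "\<rho> permutes half_arcs G"
    using bij(1) unfolding \<rho>_def bij_iff permutes_def
    by (simp add: rotation_of_steps_def half_arcs_def)
  have alt: "is_Entering (\<rho> k) \<longleftrightarrow> \<not> is_Entering k" if "k \<in> half_arcs G" for k
    using that by (cases k) (auto simp: \<rho> half_arcs_def)
  have "cyclic_on \<rho> (half_arcs_at G v)" if "v \<in> verts G" and ne: "half_arcs_at G v \<noteq> {}" for v
  proof -
    let ?X = "{a \<in> arcs G. head G a = v}"
    obtain k where k: "arc_of k \<in> arcs G" "half_arc_vertex G k = v"
      using ne by (auto simp: half_arcs_at_def half_arcs_def)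
    have "\<exists>a. a \<in> ?X"
    proof (cases k)
      case (Leaving x)
      then show ?thesis using k tail' in_arcs(4) by (intro exI[of _ "inv t x"]) auto
    qed (use k in auto)
    then obtain a where a: "a \<in> arcs G" "head G a = v" by auto
    have X: "orbit (inv t \<circ> s) a = ?X"
      using orbit_cyclic_eq3[OF cyc[rule_format, of v], of a] a by auto
    have E: "Entering b \<in> orbit \<rho> (Entering a)" if "b \<in> orbit (inv t \<circ> s) a" for b
      using that
    proof (induction rule: orbit.induct)
      case base
      have "\<rho> (\<rho> (Entering a)) = Entering ((inv t \<circ> s) a)" using \<rho> a in_arcs(1) by simp
      then show ?case by (metis orbit.base orbit.step)
    next
      case (step b)
      then have "b \<in> arcs G" using X by auto
      then have "\<rho> (\<rho> (Entering b)) = Entering ((inv t \<circ> s) b)" using \<rho> in_arcs(1) by simp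
      then show ?case using step.IH by (metis orbit.step)
    qed
    have "half_arcs_at G v \<subseteq> orbit \<rho> (Entering a)"
    proof
      fix k assume k: "k \<in> half_arcs_at G v"
      show "k \<in> orbit \<rho> (Entering a)"
      proof (cases k)
        case (Entering b)
        then show ?thesis using k E X by (auto simp: half_arcs_at_def half_arcs_def)
      next
        case (Leaving x)
        then have x: "x \<in> arcs G" "tail G x = v" using k by (auto simp: half_arcs_at_def half_arcs_def)
        \<comment> \<open>\<open>Entering b\<close> is the half-arc just before
          \<open>Leaving x\<close> in the rotation.\<close>
        define b where "b = inv s x"
        have b: "b \<in> arcs G" "s b = x"
          using x in_arcs(3) permutes_inverses(1)[OF s] by (auto simp: b_def)
        have "(inv t \<circ> s) b \<in> {a \<in> arcs G. head G a = head G b}"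
          using b cyclic_on_inI[OF cyc[rule_format, of "head G b"], of b] by blast
        then have "head G b = v" using b x tail' by simp
        then have "Entering b \<in> orbit \<rho> (Entering a)" using E X b by blast
        then show ?thesis using orbit.step \<rho>(1)[OF b(1)] b Leaving by metis
      qed
    qed
    moreover have "orbit \<rho> (Entering a) \<subseteq> half_arcs_at G v"
    proof
      have step: "\<rho> k \<in> half_arcs_at G v" if "k \<in> half_arcs_at G v" for k
      proof (cases k)
        case (Entering b)
        then have b: "b \<in> arcs G" "head G b = v" using that by (auto simp: half_arcs_at_def half_arcs_def)
        then have "(inv t \<circ> s) b \<in> ?X" using cyclic_on_inI[OF cyc[rule_format, of v], of b] by blast
        then have "tail G (s b) = v" using tail'[of "s b"] in_arcs(1) b by simp
        then show ?thesis using Entering b \<rho> in_arcs(1) by (simp add: half_arcs_at_def half_arcs_def)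
      next
        case (Leaving x)
        then show ?thesis using that \<rho> tail' in_arcs(4) by (auto simp: half_arcs_at_def half_arcs_def)
      qed
      have base: "Entering a \<in> half_arcs_at G v" using a by (simp add: half_arcs_at_def half_arcs_def)
      fix k assume "k \<in> orbit \<rho> (Entering a)"
      then show "k \<in> half_arcs_at G v" by induction (use step base in blast)+
    qed
    moreover have "Entering a \<in> half_arcs_at G v" using a by (simp add: half_arcs_at_def half_arcs_def)
    ultimately show ?thesis unfolding cyclic_on_def by blast
  qed
  then show "oriented_directed_embedding G \<rho>"
    unfolding oriented_directed_embedding_def using perm alt by blast
qed

section \<open>Closed walks, parity and the number of faces\<close>

lemma (in pre_digraph) cas_iff_successively:
  "p \<noteq> [] \<Longrightarrow> cas u p v \<longleftrightarrow>
    u = tail G (hd p) \<and> v = head G (last p) \<and> successively (\<lambda>a b. head G a = tail G b) p"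
proof (induction p arbitrary: u)
  case (Cons a p)
  then show ?case by (cases p) auto
qed simp

text \<open>The step of the cycle from the last arc back to the first one expresses that the walk is
  closed.\<close>

lemma (in pre_digraph) closed_cas_iff_cycle:
  assumes "distinct p" "p \<noteq> []"
  shows "(\<exists>u. cas u p u) \<longleftrightarrow> (\<forall>a\<in>set p. tail G (cycle_of_list p a) = head G a)"
proof
  assume "\<exists>u. cas u p u"
  then have p: "tail G (hd p) = head G (last p)" "successively (\<lambda>a b. head G a = tail G b) p"
    using assms by (auto simp: cas_iff_successively)
  show "\<forall>a\<in>set p. tail G (cycle_of_list p a) = head G a"
  proof
    fix a assume a: "a \<in> set p"
    show "tail G (cycle_of_list p a) = head G a"
    proof (cases "a = last p")
      case True
      then show ?thesis using p(1) cycle_of_list_last[OF assms] by simp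
    next
      case False
      then obtain X b Y where eq: "p = X @ a # b # Y" using split_at_not_last a by metis
      then have "cycle_of_list p a = b" using cycle_of_list_next assms by metis
      moreover have "head G a = tail G b" using p(2) unfolding eq by (simp add: successively_append_iff)
      ultimately show ?thesis by simp
    qed
  qed
next
  assume R: "\<forall>a\<in>set p. tail G (cycle_of_list p a) = head G a"
  have "successively (\<lambda>a b. head G a = tail G b) p"
    unfolding successively_conv_nth using R cycle_of_list_nth[OF assms(1)]
    by (metis Suc_lessD mod_less nth_mem)
  moreover have "tail G (hd p) = head G (last p)"
    using R assms cycle_of_list_last[OF assms] by (metis last_in_set)
  ultimately show "\<exists>u. cas u p u"
    using assms by (auto simp: cas_iff_successively)
qed


text \<open>The rotation is one cycle on the arcs entering each vertex, whatever the embedding, so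
  this sign depends on the digraph alone.\<close>

lemma (in fin_digraph) embedding_parity:
  assumes "oriented_directed_embedding G \<rho>"
  shows "sign (proface_step \<rho>) * sign (antiface_step \<rho>) =
    (if even (card (head G ` arcs G) + card (arcs G)) then 1 else - 1)"
proof -
  note steps = embedding_steps[OF assms]
  have perm: "permutation (proface_step \<rho>)" "permutation (antiface_step \<rho>)"
    by (rule permutes_imp_permutation[OF finite_arcs] steps(1,2))+
  have "sign (inv (proface_step \<rho>) \<circ> antiface_step \<rho>) = sign (proface_step \<rho>) * sign (antiface_step \<rho>)"
    using perm by (simp add: sign_compose permutation_inverse sign_inverse)
  moreover have "inv (proface_step \<rho>) \<circ> antiface_step \<rho> permutes arcs G"
    using steps(1,2) by (intro permutes_compose permutes_inv)
  ultimately show ?thesis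
    using sign_cyclic_blocks[OF _ finite_arcs steps(3)] by metis
qed

text \<open>With only two faces, both face steps are cycles through all arcs and have the same sign,
  so the parity is even. In the odd case at least three faces are forced.\<close>

lemma (in fin_digraph) card_faces:
  assumes "oriented_directed_embedding G \<rho>" "arcs G \<noteq> {}"
  shows "card (faces G \<rho>) = card (profaces G \<rho>) + card (antifaces G \<rho>)"
    "card (profaces G \<rho>) \<ge> 1" "card (antifaces G \<rho>) \<ge> 1"
    "card (profaces G \<rho>) = 1 \<Longrightarrow> card (antifaces G \<rho>) = 1 \<Longrightarrow>
      even (card (head G ` arcs G) + card (arcs G))"
proof -
  have fin: "finite (profaces G \<rho>)" "finite (antifaces G \<rho>)"
    by (auto simp: profaces_def antifaces_def)
  then show "card (faces G \<rho>) = card (profaces G \<rho>) + card (antifaces G \<rho>)"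
    unfolding faces_def by (rule card_Plus)
  show "card (profaces G \<rho>) \<ge> 1" "card (antifaces G \<rho>) \<ge> 1"
    using fin assms(2) by (auto simp: Suc_le_eq card_gt_0_iff profaces_def antifaces_def)
  assume "card (profaces G \<rho>) = 1" "card (antifaces G \<rho>) = 1"
  then have "sign (proface_step \<rho>) = sign (antiface_step \<rho>)"
    using sign_single_walk[OF _ finite_arcs assms(2)] embedding_steps(1,2)[OF assms(1)]
    unfolding profaces_def antifaces_def by metis
  then show "even (card (head G ` arcs G) + card (arcs G))"
    using embedding_parity[OF assms(1)] by (auto split: if_splits)
qed

section \<open>From the minimum degree to the embedding and its genus\<close>

lemma out_degree_underlying_simple:
  "out_degree (with_proj (underlying_simple D)) v =
    card {x. x \<noteq> v \<and> (\<exists>a\<in>arcs D. {tail D a, head D a} = {v, x})}"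
proof -
  have "out_arcs (with_proj (underlying_simple D)) v =
      Pair v ` {x. x \<noteq> v \<and> (\<exists>a\<in>arcs D. {tail D a, head D a} = {v, x})}"
    by (auto simp: out_arcs_def underlying_simple_def with_proj_def doubleton_eq_iff image_iff)
  then show ?thesis by (simp add: out_degree_def card_image inj_on_def)
qed

theorem corollary4p2:
  fixes D :: "('a, 'b) pre_digraph" and T :: "'b list set" and n :: nat
  assumes "eulerian_digraph D"
    and "n = card (verts D)"
    and "real (min_degree (with_proj (underlying_simple D))) \<ge> (4 * real n + 2) / 5"
    and "directed_euler_circuit D T"
  shows "\<exists>\<rho>. oriented_directed_embedding D \<rho> \<and>
           profaces D \<rho> = {T} \<and>
           card (antifaces D \<rho>) = (if even (card (verts D) + card (arcs D)) then 1 else 2) \<and>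
           (\<forall>\<rho>'. oriented_directed_embedding D \<rho>' \<longrightarrow> genus D \<rho>' \<le> genus D \<rho>) \<and>
           (even (card (verts D) + card (arcs D)) \<longrightarrow> bi_eulerian D \<rho> \<and> Inl T \<in> faces D \<rho>)"
proof -
  interpret fin_digraph D using assms(1) by (simp add: eulerian_digraph_def)
  obtain u p where p: "euler_trail u p u" and T: "T = cyclic_walk p"
    using assms(4) by (auto simp: directed_euler_circuit_def)
  have dp: "distinct p" "set p = arcs D" and u: "u \<in> verts D" and cas: "cas u p u"
    using p by (auto simp: euler_trail_def trail_def awalk_def)
  define N where "N v = {x. x \<noteq> v \<and> (\<exists>a\<in>arcs D. {tail D a, head D a} = {v, x})}" for v
  have N: "N v \<subseteq> verts D - {v}" for v
    unfolding N_def using tail_in_verts head_in_verts by (auto simp: doubleton_eq_iff)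
  have cardN: "4 * n + 2 \<le> 5 * card (N v)" if "v \<in> verts D" for v
  proof -
    have "min_degree (with_proj (underlying_simple D)) \<le> card (N v)"
      unfolding min_degree_def N_def out_degree_underlying_simple[symmetric]
      using that by (intro Min_le) (auto simp: underlying_simple_def)
    then have "(4 * real n + 2) / 5 \<le> real (card (N v))" using assms(3) by linarith
    then have "real (4 * n + 2) \<le> real (5 * card (N v))" by simp
    then show ?thesis by (simp only: of_nat_le_iff)
  qed
  \<comment> \<open>Together with the degree bound this gives
    \<open>4 * n + 2 \<le> 5 * (n - 1)\<close>, which forces at least seven vertices.\<close>
  have "card (N u) \<le> n - 1"
    using card_mono[OF _ N[of u]] u assms(2) by simp
  then have n: "7 \<le> n" using cardN[OF u] by linarith
  have "N u \<noteq> {}" using cardN[OF u] by fastforce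
  then have arcs: "arcs D \<noteq> {}" by (auto simp: N_def)
  then have "p \<noteq> []" using dp by auto
  let ?t = "cycle_of_list p"
  have t: "?t permutes arcs D" using cycle_permutes[of p] dp by simp
  have tail: "\<forall>a\<in>arcs D. tail D (?t a) = head D a"
    using closed_cas_iff_cycle[OF dp(1) \<open>p \<noteq> []\<close>] cas dp(2) by blast
  have tail': "head D (inv ?t a) = tail D a" if "a \<in> arcs D" for a
    using tail[rule_format, of "inv ?t a"] permutes_inverses(1)[OF t] permutes_in_image[OF permutes_inv[OF t]] that
    by simp
  have heads: "head D ` arcs D = verts D"
  proof
    show "verts D \<subseteq> head D ` arcs D"
    proof
      fix v assume v: "v \<in> verts D"
      then have "N v \<noteq> {}" using cardN[OF v] by fastforce
      then obtain a where a: "a \<in> arcs D" "tail D a = v \<or> head D a = v"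
        by (auto simp: N_def doubleton_eq_iff)
      then show "v \<in> head D ` arcs D"
        using tail'[of a] permutes_in_image[OF permutes_inv[OF t], of a] by (metis image_eqI)
    qed
  qed (use head_in_verts in auto)
  \<comment> \<open>At most \<open>n - 1 - (4 * n + 2) / 5 = (n - 7) / 5\<close> other vertices are
    not adjacent to a given one, and the integer part \<open>q\<close> of this satisfies
    \<open>5 * q + 7 \<le> n\<close>.\<close>
  interpret dense_circuit p "head D" "(n - 7) div 5"
  proof
    show "distinct p" by (rule dp)
    show "5 * ((n - 7) div 5) + 7 \<le> card (head D ` set p)"
      using n assms(2) by (simp add: dp heads)
    show "card {x \<in> head D ` set p. x \<noteq> v \<and> \<not> (\<exists>a\<in>set p. {head D (inv ?t a), head D a} = {v, x})}
        \<le> (n - 7) div 5" if "v \<in> head D ` set p" for v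
    proof -
      have v: "v \<in> verts D" using that by (simp add: dp heads)
      have "{x \<in> head D ` set p. x \<noteq> v \<and> \<not> (\<exists>a\<in>set p. {head D (inv ?t a), head D a} = {v, x})}
          = (verts D - {v}) - N v"
        using tail' by (auto simp: dp heads N_def)
      moreover have "card ((verts D - {v}) - N v) = n - 1 - card (N v)"
        using N v assms(2) finite_subset[OF N] by (simp add: card_Diff_subset)
      ultimately show ?thesis using cardN[OF v] by (simp add: less_eq_div_iff_mult_less_eq)
    qed
  qed
  obtain p1 p2 where p12: "distinct (p1 @ p2)" "set (p1 @ p2) = set p" "p1 \<noteq> []"
    and "\<forall>a\<in>set p. head D (twist (cycle_of_list p1 \<circ> cycle_of_list p2) a) = head D a"
    and "\<forall>v\<in>head D ` set p.
      cyclic_on (twist (cycle_of_list p1 \<circ> cycle_of_list p2)) (block v)"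
    by (rule cyclic_blocks)
  then have pres: "\<forall>a\<in>arcs D. head D (inv ?t ((cycle_of_list p1 \<circ> cycle_of_list p2) a)) = head D a"
    and cyc: "\<forall>v\<in>head D ` arcs D.
      cyclic_on (inv ?t \<circ> (cycle_of_list p1 \<circ> cycle_of_list p2)) {a \<in> arcs D. head D a = v}"
    unfolding twist_def block_def dp(2) by simp_all
  note p12 = p12[unfolded dp(2)]
  let ?s = "cycle_of_list p1 \<circ> cycle_of_list p2"
  have s: "?s permutes arcs D"
    using p12(2) by (intro permutes_compose) (auto intro: permutes_subset[OF cycle_permutes])
  define \<rho> where "\<rho> = rotation_of_steps (arcs D) ?s ?t"
  note emb = embedding_of_steps[OF s t tail cyc, folded \<rho>_def]
  have pro: "profaces D \<rho> = {T}"
    unfolding profaces_def emb(3) T dp(2)[symmetric]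
    using cyclic_walks_of_cycle[OF dp(1), of ?t] \<open>p \<noteq> []\<close> by simp
  have anti: "antifaces D \<rho> = {cyclic_walk p1} \<union> (if p2 = [] then {} else {cyclic_walk p2})"
    unfolding antifaces_def emb(2) p12(2)[symmetric]
    using cyclic_walks_of_two_cycles[OF p12(1)] p12(3) by simp
  have card_anti: "card (antifaces D \<rho>) = (if p2 = [] then 1 else 2)"
  proof -
    have "cyclic_walk p1 \<noteq> cyclic_walk p2" if "p2 \<noteq> []"
      using cyclic_walk_eq_imp_set_eq[of p1 p2] p12(1,3) by auto
    then show ?thesis unfolding anti by simp
  qed
  \<comment> \<open>\<open>?t\<close> is one cycle through all arcs and \<open>?s\<close> consists
    of one or two cycles, so the product of their signs tells the two cases apart;
    \<open>embedding_parity\<close> computes it from the digraph.\<close>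
  have parity: "p2 = [] \<longleftrightarrow> even (card (verts D) + card (arcs D))"
  proof -
    have "sign ?t = (- 1) ^ (card (arcs D) - 1)"
      using sign_cycle_of_list[OF dp(1)] distinct_card[OF dp(1)] dp(2) by simp
    moreover have "distinct p1" "distinct p2" using p12(1) by auto
    \<comment> \<open>For \<open>p2 = []\<close> the truncated exponent is zero and the factor is
      one.\<close>
    then have "sign ?s = (- 1) ^ (length p1 - 1) * (- 1) ^ (length p2 - 1)"
      unfolding sign_compose[OF permutation_of_cycle permutation_of_cycle]
      by (simp add: sign_cycle_of_list)
    moreover have "card (arcs D) = length p1 + length p2"
      using distinct_card[OF p12(1)] p12(2) by simp
    moreover have "length p1 > 0" using p12(3) by simp
    ultimately have "sign ?t * sign ?s = (if p2 = [] then 1 else - 1)"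
      by (cases p1; cases p2) (auto simp: power_add[symmetric] uminus_power_if)
    then show ?thesis
      using embedding_parity[OF emb(1)] unfolding emb(2,3) heads by (auto split: if_splits)
  qed
  have faces: "card (faces D \<rho>) = (if even (card (verts D) + card (arcs D)) then 2 else 3)"
    using card_faces(1)[OF emb(1) arcs] card_anti pro parity by simp
  have max: "genus D \<rho>' \<le> genus D \<rho>" if "oriented_directed_embedding D \<rho>'" for \<rho>'
  proof -
    note f = card_faces[OF that arcs, unfolded heads]
    \<comment> \<open>By Euler's formula the genus is largest when the faces are fewest; the lower
      bounds two and three come from \<open>card_faces\<close>.\<close>
    have "card (faces D \<rho>) \<le> card (faces D \<rho>')"
    proof (cases "even (card (verts D) + card (arcs D))")
      case True
      then show ?thesis using f faces by simp
    next
      case False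
      then have "\<not> (card (profaces D \<rho>') = 1 \<and> card (antifaces D \<rho>') = 1)" using f(4) by blast
      moreover have "card (faces D \<rho>) = 3" using faces False by (simp only: if_False)
      ultimately show ?thesis using f(1-3) by linarith
    qed
    then show ?thesis by (simp add: genus_def)
  qed
  have bi: "bi_eulerian D \<rho>" if even: "even (card (verts D) + card (arcs D))"
  proof -
    have p2: "p2 = []" using parity even by simp
    then have p1: "distinct p1" "set p1 = arcs D" using p12 by auto
    \<comment> \<open>\<open>head D (inv ?t b)\<close> is the tail of \<open>b\<close>, so
      \<open>pres\<close> says that the antiface is a directed closed walk.\<close>
    have "tail D (cycle_of_list p1 a) = head D a" if "a \<in> arcs D" for a
      using pres tail'[of "cycle_of_list p1 a"] permutes_in_image[OF s, of a] that p2 by simp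
    then obtain v where v: "cas v p1 v"
      using closed_cas_iff_cycle[OF p1(1) p12(3)] p1(2) by blast
    have "v = tail D (hd p1)" using v cas_iff_successively[OF p12(3)] by simp
    then have "v \<in> verts D" using p1 p12(3) by (metis hd_in_set tail_in_verts)
    moreover have "set (awalk_verts v p1) = verts D"
    proof -
      have "verts D \<subseteq> tail D ` arcs D"
        using tail permutes_in_image[OF t] unfolding heads[symmetric] by (metis (no_types, lifting) image_iff subsetI)
      then have "tail D ` arcs D = verts D" using tail_in_verts by blast
      moreover have last: "last p1 \<in> arcs D" using p1 p12(3) last_in_set by metis
      ultimately show ?thesis
        unfolding awalk_verts_conv using p12(3) p1 head_in_verts[OF last] by auto
    qed
    ultimately have "euler_trail v p1 v"
      using v p1 by (simp add: euler_trail_def trail_def awalk_def)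
    then have "directed_euler_circuit D (cyclic_walk p1)"
      by (auto simp: directed_euler_circuit_def)
    then show ?thesis
      unfolding bi_eulerian_def using emb(1) faces even pro anti p2 assms(4) by auto
  qed
  show ?thesis
    using emb(1) pro card_anti parity max bi by (intro exI[of _ \<rho>]) (auto simp: faces_def)
qed

end
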